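(* Let $I_M>0$, $R$, $R'$, $b$, $Q$, $u_0$ satisfy assumptions (A1)--(A8) listed in the context. Then there exists at most one pair $(u,I)$ such that $I\in C([0,\infty))$ is strictly increasing with values in $[0,\infty)$, and $u\in C(\mathbb{R}\times[0,\infty))$ solves $$\begin{cases} u_t=(u_x)^2+R(x,I(t)) & \text{in } \mathbb{R}\times(0,\infty),\\ \max_{x\in\mathbb{R}} u(x,t)=0 & \text{for all } t\in[0,\infty),\\ u(x,0)=u_0(x) & \text{for all } x\in\mathbb{R},\end{cases}$$ where the first equation is understood in the viscosity sense.
   Context: Data: a constant $I_M>0$, a function $u_0:\mathbb{R}\to\mathbb{R}$, and a function $R:\mathbb{R}\times[0,\infty)\to\mathbb{R}$ of the form $$R(x,I)=\begin{cases} b(x)-Q(I) & \text{for } x\ge 0,\\ R'(x,I) & \text{for } x<0,\end{cases}$$ where $R'$ is the name of a function on $(-\infty,0)\times[0,\infty)$ (it does not denote a derivative), $b:[0,\infty)\to\mathbb{R}$ and $Q:[0,\infty)\to\mathbb{R}$. Assumptions: (A1) $R$ is smooth, and $R'(x,I)<0$ for all $x\in(-\infty,0)$ and all $I>0$; (A2) $\sup_{0\le I\le I_M}\|R(\cdot,I)\|_{W^{2,\infty}(\mathbb{R})}<\infty$, and $R$ is strictly decreasing in $I$; (A3) $Q(I)\ge 0$ is strictly increasing in $I$ and $Q(0)=0$; (A4) $\sup_{x\in\mathbb{R}}R(x,I_M)=0$; (A5) $\min_{x\in\mathbb{R}}R(x,0)=0$; (A6) $b$ is strictly increasing on $[0,\infty)$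 with $b(0)=0$; (A7) $b'$ is Lipschitz continuous (and hence, $b$ being increasing, $b'\ge0$); (A8) $u_0\in C^2(\mathbb{R})$ with $\|u_0\|_{C^2(\mathbb{R})}<\infty$, $\max_{\mathbb{R}}u_0=u_0(0)=0$, and $u_0(x)<0$ for all $x\ne 0$. *)

theory Defs
  imports "HOL-Analysis.Analysis" "HOL-Probability.Essential_Supremum"
begin

definition C_k :: "nat \<Rightarrow> (real \<Rightarrow> real) \<Rightarrow> bool" where
  "C_k k f \<longleftrightarrow>
     (\<forall>j<k. (deriv ^^ j) f differentiable_on UNIV) \<and> continuous_on UNIV ((deriv ^^ k) f)"

definition C_k_norm :: "nat \<Rightarrow> (real \<Rightarrow> real) \<Rightarrow> ereal" where
  "C_k_norm k f = (\<Sum>j\<le>k. SUP x. ereal \<bar>(deriv ^^ j) f x\<bar>)"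

text \<open>Smoothness up to the boundary on the closed half-plane: all mixed partial derivatives
  exist (one-sided in the second variable on the boundary) and are jointly continuous;
  \<open>D i j\<close> is the derivative of order \<open>i\<close> in the first and \<open>j\<close> in the second variable.\<close>

definition smooth_half_plane :: "(real \<Rightarrow> real \<Rightarrow> real) \<Rightarrow> bool" where
  "smooth_half_plane F \<longleftrightarrow>
     (\<exists>D :: nat \<Rightarrow> nat \<Rightarrow> real \<Rightarrow> real \<Rightarrow> real.
        (\<forall>x. \<forall>s\<ge>0. D 0 0 x s = F x s) \<and>
        (\<forall>i j. continuous_on (UNIV \<times> {0..}) (\<lambda>(x, s). D i j x s)) \<and>
        (\<forall>i j x. \<forall>s\<ge>0.
           ((\<lambda>y. D i j y s) has_real_derivative D (Suc i) j x s) (at x) \<and>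
           ((\<lambda>r. D i j x r) has_real_derivative D i (Suc j) x s) (at s within {0..})))"

definition test_function :: "(real \<Rightarrow> real) \<Rightarrow> bool" where
  "test_function \<phi> \<longleftrightarrow> (\<forall>k. C_k k \<phi>) \<and> compact (closure {x. \<phi> x \<noteq> 0})"

definition locally_integrable :: "(real \<Rightarrow> real) \<Rightarrow> bool" where
  "locally_integrable f \<longleftrightarrow> (\<forall>K. compact K \<longrightarrow> set_integrable lebesgue K f)"

definition weak_derivative :: "(real \<Rightarrow> real) \<Rightarrow> (real \<Rightarrow> real) \<Rightarrow> bool" where
  "weak_derivative f g \<longleftrightarrow>
     locally_integrable f \<and> locally_integrable g \<and>
     (\<forall>\<phi>. test_function \<phi> \<longrightarrow>
        (LINT x|lebesgue. f x * deriv \<phi> x) = - (LINT x|lebesgue. g x * \<phi> x))"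

text \<open>Weak derivatives are unique up to null sets, so the infimum ranges over a single value,
  or over the empty set, in which case it is \<open>\<infinity>\<close>.\<close>

definition W2_inf_norm :: "(real \<Rightarrow> real) \<Rightarrow> ereal" where
  "W2_inf_norm f =
     (INF (g, h) \<in> {(g, h). weak_derivative f g \<and> weak_derivative g h}.
        esssup lebesgue (\<lambda>x. ereal \<bar>f x\<bar>) + esssup lebesgue (\<lambda>x. ereal \<bar>g x\<bar>)
        + esssup lebesgue (\<lambda>x. ereal \<bar>h x\<bar>))"

definition has_maximum :: "(real \<Rightarrow> real) \<Rightarrow> real \<Rightarrow> bool" where
  "has_maximum f m \<longleftrightarrow> (\<exists>x. f x = m) \<and> (\<forall>x. f x \<le> m)"

definition has_minimum :: "(real \<Rightarrow> real) \<Rightarrow> real \<Rightarrow> bool" where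
  "has_minimum f m \<longleftrightarrow> (\<exists>x. f x = m) \<and> (\<forall>x. m \<le> f x)"

definition C1_partials ::
  "(real \<Rightarrow> real \<Rightarrow> real) \<Rightarrow> (real \<Rightarrow> real \<Rightarrow> real) \<Rightarrow> (real \<Rightarrow> real \<Rightarrow> real) \<Rightarrow> bool" where
  "C1_partials \<phi> \<phi>x \<phi>t \<longleftrightarrow>
     continuous_on (UNIV \<times> {0<..}) (\<lambda>(x, t). \<phi>x x t) \<and>
     continuous_on (UNIV \<times> {0<..}) (\<lambda>(x, t). \<phi>t x t) \<and>
     (\<forall>x. \<forall>t>0. ((\<lambda>y. \<phi> y t) has_real_derivative \<phi>x x t) (at x) \<and>
                ((\<lambda>s. \<phi> x s) has_real_derivative \<phi>t x t) (at t))"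

text \<open>Viscosity sub- and supersolutions of \<open>u\<^sub>t = H(x, t, u\<^sub>x)\<close> in \<open>\<real> \<times> (0, \<infinity>)\<close>,
  for continuous \<open>u\<close>.\<close>

definition viscosity_subsolution ::
  "(real \<Rightarrow> real \<Rightarrow> real \<Rightarrow> real) \<Rightarrow> (real \<Rightarrow> real \<Rightarrow> real) \<Rightarrow> bool" where
  "viscosity_subsolution H u \<longleftrightarrow>
     (\<forall>\<phi> \<phi>x \<phi>t x t. C1_partials \<phi> \<phi>x \<phi>t \<and> t > 0 \<and>
        (\<forall>\<^sub>F (y, s) in nhds (x, t). u y s - \<phi> y s \<le> u x t - \<phi> x t)
        \<longrightarrow> \<phi>t x t \<le> H x t (\<phi>x x t))"

definition viscosity_supersolution ::
  "(real \<Rightarrow> real \<Rightarrow> real \<Rightarrow> real) \<Rightarrow> (real \<Rightarrow> real \<Rightarrow> real) \<Rightarrow> bool" where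
  "viscosity_supersolution H u \<longleftrightarrow>
     (\<forall>\<phi> \<phi>x \<phi>t x t. C1_partials \<phi> \<phi>x \<phi>t \<and> t > 0 \<and>
        (\<forall>\<^sub>F (y, s) in nhds (x, t). u x t - \<phi> x t \<le> u y s - \<phi> y s)
        \<longrightarrow> H x t (\<phi>x x t) \<le> \<phi>t x t)"

definition viscosity_solution ::
  "(real \<Rightarrow> real \<Rightarrow> real \<Rightarrow> real) \<Rightarrow> (real \<Rightarrow> real \<Rightarrow> real) \<Rightarrow> bool" where
  "viscosity_solution H u \<longleftrightarrow> viscosity_subsolution H u \<and> viscosity_supersolution H u"

text \<open>Values of \<open>R x s\<close>, \<open>I t\<close> and \<open>u x t\<close> at negative \<open>s\<close> or \<open>t\<close> are irrelevant.\<close>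

definition constrained_HJ_solution ::
  "(real \<Rightarrow> real \<Rightarrow> real) \<Rightarrow> (real \<Rightarrow> real) \<Rightarrow> (real \<Rightarrow> real \<Rightarrow> real) \<Rightarrow> (real \<Rightarrow> real) \<Rightarrow> bool" where
  "constrained_HJ_solution R u0 u I \<longleftrightarrow>
     continuous_on {0..} I \<and> strict_mono_on {0..} I \<and> (\<forall>t\<ge>0. 0 \<le> I t) \<and>
     continuous_on (UNIV \<times> {0..}) (\<lambda>(x, t). u x t) \<and>
     viscosity_solution (\<lambda>x t p. p\<^sup>2 + R x (I t)) u \<and>
     (\<forall>t\<ge>0. has_maximum (\<lambda>x. u x t) 0) \<and>
     (\<forall>x. u x 0 = u0 x)"

end

theory Submission
  imports Defs
begin

text \<open>
  Let \<open>m t\<close> be the integral of \<open>Q (I s)\<close> over \<open>0 \<le> s \<le> t\<close> and let \<open>U = u + m\<close>. Then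
  \<open>U\<^sub>t = U\<^sub>x\<^sup>2 + F\<close> with \<open>F x t = R x (I t) + Q (I t)\<close>, the maximum of \<open>U\<close> at time \<open>t\<close> is \<open>m t\<close>, and
  on \<open>x \<ge> 0\<close> the source \<open>F\<close> is just \<open>b\<close>, whatever \<open>I\<close> is. Heuristically, \<open>U x t\<close> is the supremum
  over all paths \<open>\<gamma>\<close> with \<open>\<gamma> t = x\<close> of \<open>u0 (\<gamma> 0)\<close> plus the integral of \<open>F (\<gamma> s) s - \<gamma>' s ^ 2 / 4\<close>. So
  if the optimal paths that lead to maximum points did not enter \<open>x < 0\<close>, then \<open>m\<close> would
  be determined by \<open>b\<close> and \<open>u0\<close> alone.

  They do not enter it, because \<open>I\<close> is increasing. Suppose such a path, with end point \<open>x\<close> at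
  time \<open>t\<close>, is last at \<open>0\<close> at time \<open>r\<close>. Then the rest of the path, which only sees \<open>b\<close>, could
  have been started at time \<open>0\<close> from the point \<open>0\<close>, where \<open>u0\<close> vanishes; it would have arrived at time
  \<open>t - r\<close> with at least the value \<open>m t - m r\<close>. Hence \<open>m t \<le> m (t - r) + m r\<close>, which for \<open>0 < r < t\<close>
  contradicts that \<open>m\<close> has a strictly increasing derivative and \<open>m 0 = 0\<close>; and \<open>r = t\<close>
  is impossible, since \<open>x > 0\<close> at a maximum point. The same path is
  available to a second solution \<open>V = v + n\<close>, and \<open>r = 0\<close> gives \<open>m t \<le> n t\<close> (lemma
  \<open>rising_maximum_le\<close>). By symmetry \<open>m = n\<close>, differentiation gives \<open>Q (I t) = Q (J t)\<close>, so
  \<open>I = J\<close>, and then \<open>u\<close> and \<open>v\<close> solve the same equation and are equal by comparison.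

  Paths occur only in discrete form. A subsolution that is bounded above admits chains of points
  along which it grows no faster than the payoff, up to a small error
  (\<open>ex_near_optimal_chain\<close>, from the Hopf-Lax bound \<open>hopf_lax_upper_bound\<close>), and a supersolution grows along
  each short segment at least as fast as the payoff (\<open>supersolution_short_segment\<close>). Together
  they give \<open>comparison_along_chain\<close>, in which the second solution may use the final part of the
  chain with shifted time.
\<close>

section \<open>Auxiliary facts on extrema and continuity\<close>

text \<open>The Hopf-Lax kernel and the time penalties below contain \<open>1 / (t - \<tau>)\<close>, which is not defined
  for all times, whereas test functions have to be differentiable everywhere. This quadratic touches
  \<open>1 / (t - \<tau>)\<close> from above to first order at \<open>t - \<tau> = a\<close> (write \<open>\<tau> = t - a + d\<close>), so it can
  replace \<open>1 / (t - \<tau>)\<close> in a test function.\<close>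
lemma reciprocal_le_quadratic:
  fixes a d :: real
  assumes "a > 0" "d \<le> a / 2"
  shows "1 / (a - d) \<le> 1 / a + d / a\<^sup>2 + 2 * d\<^sup>2 / a ^ 3"
proof -
  have pos: "a - d > 0" using assms by simp
  have "2 * d\<^sup>2 / a ^ 3 - d\<^sup>2 / (a\<^sup>2 * (a - d)) = d\<^sup>2 * (a - 2 * d) / (a ^ 3 * (a - d))"
    using assms pos by (simp add: divide_simps power2_eq_square power3_eq_cube) (simp add: algebra_simps)
  also have "\<dots> \<ge> 0" using assms pos by simp
  finally have "d\<^sup>2 / (a\<^sup>2 * (a - d)) \<le> 2 * d\<^sup>2 / a ^ 3" by simp
  moreover have "1 / (a - d) = 1 / a + d / a\<^sup>2 + d\<^sup>2 / (a\<^sup>2 * (a - d))"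
    using assms pos by (simp add: divide_simps power2_eq_square) (simp add: algebra_simps)
  ultimately show ?thesis by simp
qed

lemma attains_sup_if_small_off_compact:
  fixes g :: "'a::topological_space \<Rightarrow> real"
  assumes "compact C" "C \<subseteq> S" "continuous_on S g" "p \<in> C"
    and off: "\<And>z. z \<in> S \<Longrightarrow> z \<notin> C \<Longrightarrow> g z \<le> g p"
  shows "\<exists>z\<in>C. \<forall>z'\<in>S. g z' \<le> g z"
proof -
  have "continuous_on C g" using assms continuous_on_subset by blast
  then obtain z where z: "z \<in> C" "\<And>z'. z' \<in> C \<Longrightarrow> g z' \<le> g z"
    using continuous_attains_sup[of C g] assms by blast
  then show ?thesis using off \<open>p \<in> C\<close> by (metis order_trans)
qed

lemma continuous_on_slice_space:
  assumes "continuous_on (UNIV \<times> {0..}) (\<lambda>(x, t). u x t)" "(s::real) \<ge> 0"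
  shows "continuous_on UNIV (\<lambda>x::real. u x s :: real)"
proof -
  have "continuous_on UNIV (\<lambda>x::real. (x, s))" by (intro continuous_intros)
  then show ?thesis using continuous_on_compose2[OF assms(1), of UNIV "\<lambda>x. (x, s)"] assms(2) by auto
qed

lemma continuous_on_slice_time:
  assumes "continuous_on (UNIV \<times> {0..}) (\<lambda>(x, t). u x t)" "continuous_on A \<gamma>" "A \<subseteq> {0..}"
  shows "continuous_on A (\<lambda>t::real. u (\<gamma> t :: real) t :: real)"
proof -
  have "continuous_on A (\<lambda>t. (\<gamma> t, t))" by (intro continuous_intros assms)
  then show ?thesis using continuous_on_compose2[OF assms(1), of A "\<lambda>t. (\<gamma> t, t)"] assms(3) by auto
qed

lemma continuous_on_comp_snd:
  fixes f :: "real \<Rightarrow> real"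
  assumes "continuous_on {0..} f"
  shows "continuous_on (UNIV \<times> {0..}) (\<lambda>z :: real \<times> real. f (snd z) :: real)"
  by (rule continuous_on_compose2[OF assms continuous_on_snd[OF continuous_on_id]]) auto

lemma continuous_on_time_change:
  fixes F :: "real \<Rightarrow> real \<Rightarrow> real" and I :: "real \<Rightarrow> real"
  assumes F: "continuous_on (UNIV \<times> {0..}) (\<lambda>(x, s). F x s)"
    and I: "continuous_on {0..} I" "\<And>t. t \<ge> 0 \<Longrightarrow> 0 \<le> I t"
  shows "continuous_on (UNIV \<times> {0..}) (\<lambda>(x, t). F x (I t))"
proof -
  have "continuous_on (UNIV \<times> {0..}) (\<lambda>z :: real \<times> real. (fst z, I (snd z)))"
    by (rule continuous_on_Pair[OF continuous_on_fst[OF continuous_on_id] continuous_on_comp_snd[OF I(1)]])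
  then have "continuous_on (UNIV \<times> {0..}) (\<lambda>z :: real \<times> real. (\<lambda>(x, s). F x s) (fst z, I (snd z)))"
    by (rule continuous_on_compose2[OF F]) (auto simp: I(2))
  then show ?thesis by (simp add: split_def)
qed

text \<open>The viscosity inequalities hold at interior times only. A penalty \<open>\<beta> / (t - \<tau>)\<close> keeps extrema
  away from the final time \<open>t\<close>; this lemma removes it again.\<close>
lemma le_at_endpoint_if_le_up_to_blowup:
  fixes \<phi> :: "real \<Rightarrow> real"
  assumes "s < t" "continuous_on {s..t} \<phi>"
    and le: "\<And>\<beta> \<tau>. \<beta> > 0 \<Longrightarrow> s \<le> \<tau> \<Longrightarrow> \<tau> < t \<Longrightarrow> \<phi> \<tau> \<le> C + \<beta> / (t - \<tau>)"
  shows "\<phi> t \<le> C"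
proof (rule continuous_le_on_closure[of "{s..<t}" \<phi>])
  fix \<tau> assume \<tau>: "\<tau> \<in> {s..<t}"
  show "\<phi> \<tau> \<le> C"
  proof (rule field_le_epsilon)
    fix e :: real assume "e > 0"
    then show "\<phi> \<tau> \<le> C + e" using le[of "e * (t - \<tau>)" \<tau>] \<tau> by auto
  qed
qed (use assms in auto)

lemma uniformly_continuous_on_box:
  assumes "continuous_on (UNIV \<times> {0..}) (\<lambda>(x, t). f x t)" "\<epsilon> > 0"
  obtains d where "d > 0" "\<And>x s y t. x \<in> {a..b::real} \<Longrightarrow> y \<in> {a..b} \<Longrightarrow> s \<in> {0..T::real} \<Longrightarrow> t \<in> {0..T} \<Longrightarrow>
    \<bar>x - y\<bar> < d \<Longrightarrow> \<bar>s - t\<bar> < d \<Longrightarrow> \<bar>f x s - f y t\<bar> < (\<epsilon>::real)"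
proof -
  have "uniformly_continuous_on ({a..b} \<times> {0..T}) (\<lambda>(x, t). f x t)"
    by (intro compact_uniformly_continuous continuous_on_subset[OF assms(1)] compact_Times) auto
  then obtain d where d: "d > 0" and
    *: "\<And>w w'. w \<in> {a..b} \<times> {0..T} \<Longrightarrow> w' \<in> {a..b} \<times> {0..T} \<Longrightarrow> dist w' w < d \<Longrightarrow>
      dist ((\<lambda>(x, t). f x t) w') ((\<lambda>(x, t). f x t) w) < \<epsilon>"
    using assms(2) unfolding uniformly_continuous_on_def by metis
  show ?thesis
  proof (rule that[of "d / 2"])
    fix x s y t assume A: "x \<in> {a..b}" "y \<in> {a..b}" "s \<in> {0..T}" "t \<in> {0..T}"
      "\<bar>x - y\<bar> < d / 2" "\<bar>s - t\<bar> < d / 2"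
    have "dist (x, s) (y, t) \<le> dist x y + dist s t"
      unfolding dist_Pair_Pair by (rule sqrt_sum_squares_le_sum) auto
    then have "dist (x, s) (y, t) < d" using A by (simp add: dist_real_def)
    with *[of "(y, t)" "(x, s)"] A show "\<bar>f x s - f y t\<bar> < \<epsilon>" by (simp add: dist_real_def)
  qed (use d in simp)
qed

section \<open>Subsolutions and the Hopf-Lax formula\<close>

text \<open>As a function of \<open>y\<close> and \<open>\<tau>\<close>, \<open>\<phi> = (x - y)\<^sup>2 / (4 * (t - \<tau>))\<close> solves \<open>\<phi>\<^sub>\<tau> = \<phi>\<^sub>y\<^sup>2\<close>. With \<open>\<phi>\<close> in
  the test function the quadratic terms of the equation therefore cancel, and only the source \<open>f\<close> is
  left at the maximum.\<close>
lemma subsolution_at_maximum: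
  assumes sub: "viscosity_subsolution (\<lambda>x t p. p\<^sup>2 + f x t) u"
    and "0 \<le> s" "s < \<theta>" "\<theta> < t" "\<beta> \<ge> 0"
    and max: "\<And>y \<tau>. s \<le> \<tau> \<Longrightarrow> \<tau> < t \<Longrightarrow>
       u y \<tau> - ((x - y)\<^sup>2 / 4 + \<beta>) / (t - \<tau>) - c * \<tau> \<le> u z \<theta> - ((x - z)\<^sup>2 / 4 + \<beta>) / (t - \<theta>) - c * \<theta>"
  shows "c + \<beta> / (t - \<theta>)\<^sup>2 \<le> f z \<theta>"
proof -
  define a where "a = t - \<theta>"
  have a: "a > 0" using assms by (simp add: a_def)
  define \<kappa> where "\<kappa> \<tau> = 1 / a + (\<tau> - \<theta>) / a\<^sup>2 + 2 * (\<tau> - \<theta>)\<^sup>2 / a ^ 3" for \<tau>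
  define \<phi> where "\<phi> y \<tau> = ((x - y)\<^sup>2 / 4 + \<beta>) * \<kappa> \<tau> + c * \<tau>" for y \<tau>
  define \<phi>x where "\<phi>x y \<tau> = (y - x) / 2 * \<kappa> \<tau>" for y \<tau>
  define \<phi>t where "\<phi>t y \<tau> = ((x - y)\<^sup>2 / 4 + \<beta>) * (1 / a\<^sup>2 + 4 * (\<tau> - \<theta>) / a ^ 3) + c" for y \<tau>
  have C1: "C1_partials \<phi> \<phi>x \<phi>t"
    unfolding C1_partials_def \<phi>_def \<phi>x_def \<phi>t_def \<kappa>_def split_def
    using a by (auto intro!: continuous_intros derivative_eq_intros simp: field_simps)
  have "\<forall>\<^sub>F (y, \<tau>) in nhds (z, \<theta>). u y \<tau> - \<phi> y \<tau> \<le> u z \<theta> - \<phi> z \<theta>"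
    unfolding eventually_nhds
  proof (intro exI[of _ "UNIV \<times> {s<..<\<theta> + a / 2}"] conjI ballI)
    show "open ((UNIV :: real set) \<times> {s<..<\<theta> + a / 2})" by (intro open_Times) auto
    show "(z, \<theta>) \<in> UNIV \<times> {s<..<\<theta> + a / 2}" using a assms by auto
    fix w assume "w \<in> (UNIV :: real set) \<times> {s<..<\<theta> + a / 2}"
    then obtain y \<tau> where w: "w = (y, \<tau>)" "s < \<tau>" "\<tau> < \<theta> + a / 2" by auto
    have "1 / (t - \<tau>) \<le> \<kappa> \<tau>"
    proof -
      have "\<tau> - \<theta> \<le> a / 2" using w(3) by simp
      from reciprocal_le_quadratic[OF a this] show ?thesis by (simp add: \<kappa>_def a_def)
    qed
    then have "((x - y)\<^sup>2 / 4 + \<beta>) * (1 / (t - \<tau>)) \<le> ((x - y)\<^sup>2 / 4 + \<beta>) * \<kappa> \<tau>"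
      using \<open>\<beta> \<ge> 0\<close> by (intro mult_left_mono) auto
    moreover have "\<kappa> \<theta> = 1 / (t - \<theta>)" by (simp add: \<kappa>_def a_def)
    moreover have "\<tau> < t" using w a by (simp add: a_def field_simps)
    ultimately show "case w of (y, \<tau>) \<Rightarrow> u y \<tau> - \<phi> y \<tau> \<le> u z \<theta> - \<phi> z \<theta>"
      using max[of \<tau> y] w by (simp add: \<phi>_def)
  qed
  with sub C1 assms(2,3) have "\<phi>t z \<theta> \<le> (\<phi>x z \<theta>)\<^sup>2 + f z \<theta>"
    unfolding viscosity_subsolution_def by (metis (no_types, lifting) le_less_trans)
  moreover have "(\<phi>x z \<theta>)\<^sup>2 = (x - z)\<^sup>2 / 4 / a\<^sup>2"
    by (simp add: \<phi>x_def \<kappa>_def power_divide power_mult_distrib power2_commute)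
  moreover have "\<phi>t z \<theta> = (x - z)\<^sup>2 / 4 / a\<^sup>2 + \<beta> / a\<^sup>2 + c"
    by (simp add: \<phi>t_def algebra_simps add_divide_distrib)
  ultimately show ?thesis by (simp add: a_def)
qed

text \<open>Consider \<open>G \<tau> = (SUP y. u y \<tau> - (x - y)\<^sup>2 / (4 * (t - \<tau>)))\<close>. By the cancellation at a maximum
  \<open>G\<close> grows at most at the rate \<open>f y \<tau>\<close>, where \<open>y\<close> is a maximiser at time \<open>\<tau>\<close>, and \<open>G\<close> is at least
  \<open>u x \<tau>\<close>, which tends to \<open>u x t\<close>. The maximisers exist because \<open>u\<close> is bounded above.\<close>
lemma hopf_lax_upper_bound:
  assumes cont: "continuous_on (UNIV \<times> {0..}) (\<lambda>(x, t). u x t)"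
    and sub: "viscosity_subsolution (\<lambda>x t p. p\<^sup>2 + f x t) u"
    and st: "0 \<le> s" "s < t"
    and bound: "\<And>y \<tau>. s \<le> \<tau> \<Longrightarrow> \<tau> \<le> t \<Longrightarrow> u y \<tau> \<le> M"
    and source: "\<And>y \<tau>. s < \<tau> \<Longrightarrow> \<tau> < t \<Longrightarrow>
      (\<And>y'. u y' \<tau> - (x - y')\<^sup>2 / (4 * (t - \<tau>)) \<le> u y \<tau> - (x - y)\<^sup>2 / (4 * (t - \<tau>))) \<Longrightarrow> f y \<tau> \<le> c"
  obtains y where "u x t \<le> u y s - (x - y)\<^sup>2 / (4 * (t - s)) + c * (t - s)"
proof -
  define h where "h = t - s"
  have h: "h > 0" using st by (simp add: h_def)
  define w where "w y = u y s - (x - y)\<^sup>2 / (4 * h)" for y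
  have cw: "continuous_on UNIV w" unfolding w_def
    by (intro continuous_intros continuous_on_slice_space[OF cont]) (use st h in auto)
  \<comment> \<open>Outside the interval of radius \<open>B\<close> the kernel alone outweighs what \<open>u\<close> can gain over \<open>u x s\<close>.\<close>
  define B where "B = sqrt (4 * h * (M - u x s))"
  have Mu: "M - u x s \<ge> 0" using bound[of s x] st by simp
  have off: "w y \<le> w x" if "y \<notin> {x - B..x + B}" for y
  proof -
    have "\<bar>x - y\<bar> > B" using that by auto
    then have "(x - y)\<^sup>2 \<ge> B\<^sup>2" 
      using h Mu by (metis B_def abs_le_square_iff abs_of_nonneg less_imp_le mult_nonneg_nonneg
          real_sqrt_ge_zero zero_le_numeral)
    moreover have "B\<^sup>2 = 4 * h * (M - u x s)" using h Mu by (simp add: B_def)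
    ultimately have "(x - y)\<^sup>2 / (4 * h) \<ge> M - u x s" using h by (simp add: field_simps)
    with bound[of s y] st show ?thesis by (simp add: w_def)
  qed
  have "x \<in> {x - B..x + B}" using h Mu by (simp add: B_def)
  then obtain y where y: "\<And>y'. w y' \<le> w y"
    using attains_sup_if_small_off_compact[OF compact_Icc[of "x - B" "x + B"] _ cw _ off] by auto
  have key: "u x \<tau> - c * (\<tau> - s) \<le> w y + \<beta> / (t - \<tau>)" if "\<beta> > 0" "s \<le> \<tau>" "\<tau> < t" for \<beta> \<tau>
  proof -
    define g where "g y \<tau> = u y \<tau> - ((x - y)\<^sup>2 / 4 + \<beta>) / (t - \<tau>) - c * \<tau>" for y \<tau>
    let ?S = "UNIV \<times> {s..<t}"
    have "continuous_on ?S (\<lambda>(y, \<tau>). u y \<tau>)"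
      using cont by (rule continuous_on_subset) (use st in auto)
    then have cg: "continuous_on ?S (\<lambda>(y, \<tau>). g y \<tau>)"
      unfolding g_def split_def by (intro continuous_intros) auto
    \<comment> \<open>Once the subtracted quotient reaches \<open>A\<close>, the value of \<open>g\<close> is below \<open>g x s\<close>; this confines the maximum to a
      compact rectangle.\<close>
    define A where "A = M + \<bar>c\<bar> * (\<bar>s\<bar> + \<bar>t\<bar>) + 1 + \<bar>g x s\<bar>"
    have low: "u y \<tau> - c * \<tau> \<le> A - 1 - \<bar>g x s\<bar>" if "s \<le> \<tau>" "\<tau> < t" for y \<tau>
    proof -
      have "\<bar>c * \<tau>\<bar> \<le> \<bar>c\<bar> * (\<bar>s\<bar> + \<bar>t\<bar>)" unfolding abs_mult using that st by (intro mult_left_mono) auto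
      then show ?thesis using bound[of \<tau> y] that by (simp add: A_def abs_le_iff)
    qed
    have A: "A > 0"
    proof -
      have "u x s - c * s \<le> A - 1 - \<bar>g x s\<bar>" using low[of s x] st by auto
      moreover have "g x s \<le> u x s - c * s" unfolding g_def using st \<open>\<beta> > 0\<close> by simp
      ultimately show ?thesis by linarith
    qed
    define D where "D = sqrt (4 * h * A)"
    define t1 where "t1 = max s (t - \<beta> / A)"
    let ?C = "{x - D..x + D} \<times> {s..t1}"
    have t1: "s \<le> t1" "t1 < t" using A \<open>\<beta> > 0\<close> st by (auto simp: t1_def)
    have off: "g y \<tau> \<le> g x s" if "(y, \<tau>) \<in> ?S" "(y, \<tau>) \<notin> ?C" for y \<tau>
    proof -
      have \<tau>: "s \<le> \<tau>" "\<tau> < t" using that by auto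
      have "((x - y)\<^sup>2 / 4 + \<beta>) / (t - \<tau>) \<ge> A"
      proof (cases "\<tau> \<le> t1")
        case False
        then have "t - \<tau> \<le> \<beta> / A" by (simp add: t1_def)
        then have "A * (t - \<tau>) \<le> \<beta>" using A by (simp add: pos_le_divide_eq mult.commute)
        also have "\<dots> \<le> (x - y)\<^sup>2 / 4 + \<beta>" by simp
        finally show ?thesis using \<tau> by (simp add: pos_le_divide_eq)
      next
        case True
        then have "\<bar>x - y\<bar> > D" using that by auto
        moreover have "D \<ge> 0" using A h by (simp add: D_def)
        ultimately have "(x - y)\<^sup>2 \<ge> D\<^sup>2" by (metis abs_le_square_iff abs_of_nonneg less_imp_le)
        moreover have "D\<^sup>2 = 4 * h * A" using h A by (simp add: D_def)
        moreover have "A * (t - \<tau>) \<le> A * h" using A \<tau> by (simp add: h_def)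
        ultimately have "A * (t - \<tau>) \<le> (x - y)\<^sup>2 / 4 + \<beta>" using \<open>\<beta> > 0\<close> by (simp add: algebra_simps)
        then show ?thesis using \<tau> by (simp add: pos_le_divide_eq)
      qed
      then show ?thesis using low[OF \<tau>, of y] unfolding g_def[of y] by (auto simp: abs_if split: if_splits)
    qed
    have "(x, s) \<in> ?C" using A h t1 by (auto simp: D_def)
    then obtain zz where zz: "zz \<in> ?C" "\<And>z'. z' \<in> ?S \<Longrightarrow> (\<lambda>(y, \<tau>). g y \<tau>) z' \<le> (\<lambda>(y, \<tau>). g y \<tau>) zz"
      using attains_sup_if_small_off_compact[of ?C ?S "\<lambda>(y, \<tau>). g y \<tau>" "(x, s)"] cg off t1
      by (force intro!: compact_Times)
    obtain z \<theta> where z: "zz = (z, \<theta>)" by force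
    then have \<theta>: "s \<le> \<theta>" "\<theta> < t" using zz(1) t1 by auto
    have max: "g y' \<tau>' \<le> g z \<theta>" if "s \<le> \<tau>'" "\<tau>' < t" for y' \<tau>'
      using zz(2)[of "(y', \<tau>')"] that z by simp
    \<comment> \<open>After time \<open>s\<close> the penalty would make the bound \<open>f z \<theta> \<le> c\<close> at the maximum fail strictly.\<close>
    have "\<theta> = s"
    proof (rule ccontr)
      assume "\<theta> \<noteq> s"
      then have "s < \<theta>" using \<theta> by simp
      have "c + \<beta> / (t - \<theta>)\<^sup>2 \<le> f z \<theta>"
        using max \<open>\<beta> > 0\<close>
        by (intro subsolution_at_maximum[OF sub st(1) \<open>s < \<theta>\<close> \<theta>(2), of \<beta> x c z]) (auto simp: g_def)
      moreover have "\<beta> / (t - \<theta>)\<^sup>2 > 0" using \<open>\<beta> > 0\<close> \<theta> by simp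
      moreover have "f z \<theta> \<le> c"
      proof (rule source[OF \<open>s < \<theta>\<close> \<theta>(2)])
        fix y'
        show "u y' \<theta> - (x - y')\<^sup>2 / (4 * (t - \<theta>)) \<le> u z \<theta> - (x - z)\<^sup>2 / (4 * (t - \<theta>))"
          using max[OF \<theta>, of y'] by (simp add: g_def add_divide_distrib)
      qed
      ultimately show False by simp
    qed
    then have "g x \<tau> \<le> g z s" using max that by simp
    moreover have "g z s \<le> w z - c * s"
      using \<open>\<beta> > 0\<close> h by (simp add: g_def w_def h_def add_divide_distrib)
    ultimately show ?thesis using y[of z] by (simp add: g_def algebra_simps)
  qed
  have "u x t - c * (t - s) \<le> w y"
    by (rule le_at_endpoint_if_le_up_to_blowup[OF \<open>s < t\<close> _ key])
      (use st in \<open>auto intro!: continuous_intros continuous_on_slice_time[OF cont]\<close>)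
  then show ?thesis using that[of y] by (simp add: w_def h_def)
qed

text \<open>The crude bound \<open>K\<close> on the source already forces the maximisers of the Hopf-Lax expression to lie
  within distance of order \<open>sqrt (t - s)\<close> from \<open>x\<close>, so the sharper bound \<open>c\<close> is only asked for there.\<close>
lemma hopf_lax_upper_bound_local:
  assumes cont: "continuous_on (UNIV \<times> {0..}) (\<lambda>(x, t). u x t)"
    and sub: "viscosity_subsolution (\<lambda>x t p. p\<^sup>2 + f x t) u"
    and st: "0 \<le> s" "s < t"
    and bound: "\<And>y \<tau>. s \<le> \<tau> \<Longrightarrow> \<tau> \<le> t \<Longrightarrow> u y \<tau> \<le> M"
    and K: "0 \<le> K" "\<And>y \<tau>. s < \<tau> \<Longrightarrow> \<tau> < t \<Longrightarrow> f y \<tau> \<le> K"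
    and source: "\<And>y \<tau>. s < \<tau> \<Longrightarrow> \<tau> < t \<Longrightarrow>
      (x - y)\<^sup>2 \<le> 4 * (t - s) * (M - u x t + K * (t - s)) \<Longrightarrow> f y \<tau> \<le> c"
  obtains y where "u x t \<le> u y s - (x - y)\<^sup>2 / (4 * (t - s)) + c * (t - s)"
proof (rule hopf_lax_upper_bound[OF cont sub st bound, of x c])
  fix y \<tau>
  assume \<tau>: "s < \<tau>" "\<tau> < t"
    and max: "\<And>y'. u y' \<tau> - (x - y')\<^sup>2 / (4 * (t - \<tau>)) \<le> u y \<tau> - (x - y)\<^sup>2 / (4 * (t - \<tau>))"
  obtain y' where "u x t \<le> u y' \<tau> - (x - y')\<^sup>2 / (4 * (t - \<tau>)) + K * (t - \<tau>)"
    by (rule hopf_lax_upper_bound[OF cont sub _ \<tau>(2), of M x K]) (use st \<tau> bound K in auto)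
  with max[of y'] have "(x - y)\<^sup>2 / (4 * (t - \<tau>)) \<le> u y \<tau> - u x t + K * (t - \<tau>)" by simp
  also have "\<dots> \<le> M - u x t + K * (t - s)"
    using bound[of \<tau> y] \<tau> K(1) by (intro add_mono mult_left_mono) auto
  finally have le: "(x - y)\<^sup>2 / (4 * (t - \<tau>)) \<le> M - u x t + K * (t - s)" .
  then have "(x - y)\<^sup>2 \<le> 4 * (t - \<tau>) * (M - u x t + K * (t - s))"
    using \<tau> by (simp add: pos_divide_le_eq mult.commute)
  also have "0 \<le> M - u x t + K * (t - s)"
    by (rule order_trans[OF _ le]) (use \<tau> in simp)
  then have "4 * (t - \<tau>) * (M - u x t + K * (t - s)) \<le> 4 * (t - s) * (M - u x t + K * (t - s))"
    using \<tau> by (intro mult_right_mono) auto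
  finally show "f y \<tau> \<le> c" by (rule source[OF \<tau>])
qed (use bound in auto)

section \<open>Supersolutions along line segments\<close>

text \<open>Here \<open>\<alpha> * \<zeta>\<^sup>2\<close> penalises the distance \<open>\<zeta>\<close> from a point moving with velocity \<open>q\<close>. With \<open>p\<close> the
  slope of the test function, \<open>p\<^sup>2 + q * p \<ge> - q\<^sup>2 / 4\<close> turns the equation into a bound without \<open>p\<close>,
  uniform in \<open>\<alpha>\<close>; the term \<open>q\<^sup>2 / 4\<close> is the cost of moving.\<close>
lemma supersolution_at_minimum:
  assumes super: "viscosity_supersolution (\<lambda>x t p. p\<^sup>2 + g x t) v"
    and "0 \<le> s" "s < \<theta>" "\<theta> < t" "\<beta> \<ge> 0" "\<bar>\<eta>\<bar> < \<rho>"
    and min: "\<And>\<zeta> \<tau>. s \<le> \<tau> \<Longrightarrow> \<tau> < t \<Longrightarrow> \<bar>\<zeta>\<bar> \<le> \<rho> \<Longrightarrow>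
       v (x + q * (\<theta> - s) + \<eta>) \<theta> + \<alpha> * \<eta>\<^sup>2 + \<beta> / (t - \<theta>) - c * \<theta>
       \<le> v (x + q * (\<tau> - s) + \<zeta>) \<tau> + \<alpha> * \<zeta>\<^sup>2 + \<beta> / (t - \<tau>) - c * \<tau>"
  shows "g (x + q * (\<theta> - s) + \<eta>) \<theta> + \<beta> / (t - \<theta>)\<^sup>2 \<le> c + q\<^sup>2 / 4"
proof -
  define a where "a = t - \<theta>"
  have a: "a > 0" using assms by (simp add: a_def)
  define z where "z = x + q * (\<theta> - s) + \<eta>"
  define \<kappa> where "\<kappa> \<tau> = 1 / a + (\<tau> - \<theta>) / a\<^sup>2 + 2 * (\<tau> - \<theta>)\<^sup>2 / a ^ 3" for \<tau>
  define \<phi> where "\<phi> y \<tau> = c * \<tau> - \<alpha> * (y - (x + q * (\<tau> - s)))\<^sup>2 - \<beta> * \<kappa> \<tau>" for y \<tau>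
  define \<phi>x where "\<phi>x y \<tau> = - 2 * \<alpha> * (y - (x + q * (\<tau> - s)))" for y \<tau>
  define \<phi>t where "\<phi>t y \<tau> = c + 2 * \<alpha> * q * (y - (x + q * (\<tau> - s))) - \<beta> * (1 / a\<^sup>2 + 4 * (\<tau> - \<theta>) / a ^ 3)" for y \<tau>
  have \<kappa>: "(\<kappa> has_real_derivative 1 / a\<^sup>2 + 4 * (\<tau> - \<theta>) / a ^ 3) (at \<tau>)" for \<tau>
    unfolding \<kappa>_def using a by (auto intro!: derivative_eq_intros simp: field_simps)
  have C1: "C1_partials \<phi> \<phi>x \<phi>t"
    unfolding C1_partials_def \<phi>_def \<phi>x_def \<phi>t_def split_def
    using a by (auto intro!: continuous_intros derivative_eq_intros \<kappa> simp: algebra_simps)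
  let ?N = "{w. \<bar>fst w - (x + q * (snd w - s))\<bar> < \<rho>} \<inter> UNIV \<times> {s<..<\<theta> + a / 2}"
  have "\<forall>\<^sub>F (y, \<tau>) in nhds (z, \<theta>). v z \<theta> - \<phi> z \<theta> \<le> v y \<tau> - \<phi> y \<tau>"
    unfolding eventually_nhds
  proof (intro exI[of _ ?N] conjI ballI)
    show "open ?N" by (intro open_Int open_Times open_Collect_less continuous_intros) auto
    show "(z, \<theta>) \<in> ?N" using a assms by (auto simp: z_def)
    fix w assume "w \<in> ?N"
    then obtain y \<tau> where w: "w = (y, \<tau>)" "\<bar>y - (x + q * (\<tau> - s))\<bar> < \<rho>" "s < \<tau>" "\<tau> < \<theta> + a / 2"
      by (cases w) auto
    have "1 / (t - \<tau>) \<le> \<kappa> \<tau>"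
    proof -
      have "\<tau> - \<theta> \<le> a / 2" using w(4) by simp
      from reciprocal_le_quadratic[OF a this] show ?thesis by (simp add: \<kappa>_def a_def)
    qed
    then have "\<beta> * (1 / (t - \<tau>)) \<le> \<beta> * \<kappa> \<tau>"
      using \<open>\<beta> \<ge> 0\<close> by (intro mult_left_mono) auto
    moreover have "\<kappa> \<theta> = 1 / (t - \<theta>)" by (simp add: \<kappa>_def a_def)
    moreover have "\<tau> < t" using w a by (simp add: a_def field_simps)
    ultimately show "case w of (y, \<tau>) \<Rightarrow> v z \<theta> - \<phi> z \<theta> \<le> v y \<tau> - \<phi> y \<tau>"
      using min[of \<tau> "y - (x + q * (\<tau> - s))"] w by (simp add: \<phi>_def z_def)
  qed
  with super C1 assms(2,3) have le: "(\<phi>x z \<theta>)\<^sup>2 + g z \<theta> \<le> \<phi>t z \<theta>"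
    unfolding viscosity_supersolution_def by (metis (no_types, lifting) le_less_trans)
  define p where "p = \<phi>x z \<theta>"
  have "\<phi>t z \<theta> = c - q * p - \<beta> / a\<^sup>2"
    by (simp add: \<phi>t_def p_def \<phi>x_def)
  moreover have "0 \<le> (p + q / 2)\<^sup>2" by simp
  then have "- (q * p) \<le> p\<^sup>2 + q\<^sup>2 / 4" by (simp add: power2_sum power_divide mult.commute)
  ultimately show ?thesis using le by (simp add: a_def z_def p_def)
qed

text \<open>A supersolution dominates the payoff of every path, and a constant velocity is the case that is
  needed. The difference between \<open>v\<close> near the moving point and the payoff is minimised over a
  tube; by the choice of \<open>\<alpha>\<close> the minimum is not on the lateral boundary of the tube, and by the equation
  it can only be at the initial time.\<close>
lemma supersolution_along_segment:
  assumes cont: "continuous_on (UNIV \<times> {0..}) (\<lambda>(x, t). v x t)"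
    and super: "viscosity_supersolution (\<lambda>x t p. p\<^sup>2 + g x t) v"
    and st: "0 \<le> s" "s < t" and "\<rho>\<^sub>0 > 0"
    and source: "\<And>y \<tau>. s < \<tau> \<Longrightarrow> \<tau> < t \<Longrightarrow> \<bar>y - (x + q * (\<tau> - s))\<bar> \<le> \<rho>\<^sub>0 \<Longrightarrow> c \<le> g y \<tau>"
  shows "v x s + (c - q\<^sup>2 / 4) * (t - s) \<le> v (x + q * (t - s)) t"
proof (rule field_le_epsilon)
  fix e :: real assume "e > 0"
  have "isCont (\<lambda>y. v y s) x"
    using continuous_on_slice_space[OF cont st(1)] by (simp add: continuous_on_eq_continuous_at)
  then obtain d where d: "d > 0" "\<And>y. \<bar>y - x\<bar> < d \<Longrightarrow> \<bar>v y s - v x s\<bar> < e"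
    using \<open>e > 0\<close> unfolding continuous_at_eps_delta dist_real_def by blast
  define \<rho> where "\<rho> = min \<rho>\<^sub>0 (d / 2)"
  have \<rho>: "\<rho> > 0" "\<rho> \<le> \<rho>\<^sub>0" "\<rho> < d" using d \<open>\<rho>\<^sub>0 > 0\<close> by (auto simp: \<rho>_def min_def)
  define w where "w \<zeta> \<tau> = v (x + q * (\<tau> - s) + \<zeta>) \<tau>" for \<zeta> \<tau>
  have cw: "continuous_on ({-\<rho>..\<rho>} \<times> {s..t}) (\<lambda>(\<zeta>, \<tau>). w \<zeta> \<tau>)"
  proof -
    have "continuous_on ({-\<rho>..\<rho>} \<times> {s..t}) (\<lambda>z. (x + q * (snd z - s) + fst z, snd z))"
      by (intro continuous_intros)
    moreover have "(\<lambda>z. (x + q * (snd z - s) + fst z, snd z)) ` ({-\<rho>..\<rho>} \<times> {s..t}) \<subseteq> UNIV \<times> {0..}"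
      using st by auto
    ultimately have "continuous_on ({-\<rho>..\<rho>} \<times> {s..t})
        (\<lambda>p. (\<lambda>(x, t). v x t) ((\<lambda>z. (x + q * (snd z - s) + fst z, snd z)) p))"
      by (rule continuous_on_compose2[OF cont])
    then show ?thesis by (simp add: w_def split_def)
  qed
  then have "bounded ((\<lambda>(\<zeta>, \<tau>). w \<zeta> \<tau>) ` ({-\<rho>..\<rho>} \<times> {s..t}))"
    by (intro compact_imp_bounded compact_continuous_image compact_Times) auto
  then obtain B where B: "B > 0" "\<And>z. z \<in> {-\<rho>..\<rho>} \<times> {s..t} \<Longrightarrow> norm ((\<lambda>(\<zeta>, \<tau>). w \<zeta> \<tau>) z) \<le> B"
    unfolding bounded_pos by blast
  have Bw: "\<bar>w \<zeta> \<tau>\<bar> \<le> B" if "\<bar>\<zeta>\<bar> \<le> \<rho>" "s \<le> \<tau>" "\<tau> \<le> t" for \<zeta> \<tau>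
    using B(2)[of "(\<zeta>, \<tau>)"] that by (auto simp: abs_le_iff)
  \<comment> \<open>On the lateral boundary the penalty exceeds the oscillation \<open>2 * B\<close> of \<open>w\<close>.\<close>
  define \<alpha> where "\<alpha> = (2 * B + 1) / \<rho>\<^sup>2"
  have \<alpha>: "\<alpha> > 0" "\<alpha> * \<rho>\<^sup>2 = 2 * B + 1" using B \<rho> by (auto simp: \<alpha>_def)
  define k where "k = c - q\<^sup>2 / 4"
  have key: "v x s - e - w 0 \<tau> + k * (\<tau> - s) \<le> 0 + \<beta> / (t - \<tau>)"
    if "\<beta> > 0" "s \<le> \<tau>" "\<tau> < t" for \<beta> \<tau>
  proof -
    define h where "h \<zeta> \<tau> = w \<zeta> \<tau> + \<alpha> * \<zeta>\<^sup>2 + \<beta> / (t - \<tau>) - k * \<tau>" for \<zeta> \<tau>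
    let ?S = "{-\<rho>..\<rho>} \<times> {s..<t}"
    have "continuous_on ?S (\<lambda>(\<zeta>, \<tau>). w \<zeta> \<tau>)"
      using cw by (rule continuous_on_subset) auto
    then have ch: "continuous_on ?S (\<lambda>(\<zeta>, \<tau>). - h \<zeta> \<tau>)"
      unfolding h_def split_def by (intro continuous_intros) auto
    \<comment> \<open>Once \<open>\<beta> / (t - \<tau>)\<close> reaches \<open>A\<close>, the value of \<open>h\<close> exceeds \<open>h 0 s\<close>.\<close>
    define A where "A = B + \<bar>k\<bar> * (\<bar>s\<bar> + \<bar>t\<bar>) + 1 + \<bar>h 0 s\<bar>"
    have "A > 0" using B(1) by (simp add: A_def add_nonneg_pos add_pos_nonneg)
    define t1 where "t1 = max s (t - \<beta> / A)"
    let ?C = "{-\<rho>..\<rho>} \<times> {s..t1}"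
    have t1: "s \<le> t1" "t1 < t" using \<open>A > 0\<close> \<open>\<beta> > 0\<close> st by (auto simp: t1_def)
    have off: "- h \<zeta> \<tau> \<le> - h 0 s" if "(\<zeta>, \<tau>) \<in> ?S" "(\<zeta>, \<tau>) \<notin> ?C" for \<zeta> \<tau>
    proof -
      have \<tau>: "s \<le> \<tau>" "\<tau> < t" "\<bar>\<zeta>\<bar> \<le> \<rho>" "\<tau> > t1" using that by auto
      then have "t - \<tau> \<le> \<beta> / A" by (simp add: t1_def)
      then have "A * (t - \<tau>) \<le> \<beta>" using \<open>A > 0\<close> by (simp add: pos_le_divide_eq mult.commute)
      then have "\<beta> / (t - \<tau>) \<ge> A" using \<tau> by (simp add: pos_le_divide_eq)
      moreover have "\<bar>k * \<tau>\<bar> \<le> \<bar>k\<bar> * (\<bar>s\<bar> + \<bar>t\<bar>)" unfolding abs_mult using \<tau> st by (intro mult_left_mono) auto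
      moreover have "\<alpha> * \<zeta>\<^sup>2 \<ge> 0" using \<alpha> by simp
      ultimately show ?thesis using Bw[of \<zeta> \<tau>] \<tau> abs_ge_self[of "h 0 s"]
        unfolding h_def[of \<zeta>] A_def by linarith
    qed
    have "\<exists>z\<in>?C. \<forall>z'\<in>?S. (\<lambda>(\<zeta>, \<tau>). - h \<zeta> \<tau>) z' \<le> (\<lambda>(\<zeta>, \<tau>). - h \<zeta> \<tau>) z"
    proof (rule attains_sup_if_small_off_compact[OF _ _ ch, of _ "(0, s)"])
      fix z assume "z \<in> ?S" "z \<notin> ?C"
      then show "(\<lambda>(\<zeta>, \<tau>). - h \<zeta> \<tau>) z \<le> (\<lambda>(\<zeta>, \<tau>). - h \<zeta> \<tau>) (0, s)"
        using off[of "fst z" "snd z"] by (cases z) auto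
    qed (use t1 \<rho> in \<open>auto intro!: compact_Times\<close>)
    then obtain \<eta> \<theta> where \<theta>: "\<bar>\<eta>\<bar> \<le> \<rho>" "s \<le> \<theta>" "\<theta> < t"
      and min: "\<And>\<zeta> \<tau>. \<bar>\<zeta>\<bar> \<le> \<rho> \<Longrightarrow> s \<le> \<tau> \<Longrightarrow> \<tau> < t \<Longrightarrow> h \<eta> \<theta> \<le> h \<zeta> \<tau>"
      using t1 by (force simp: abs_le_iff)
    have "\<theta> = s"
    proof (rule ccontr)
      assume "\<theta> \<noteq> s"
      then have "s < \<theta>" using \<theta> by simp
      have "\<bar>\<eta>\<bar> \<noteq> \<rho>"
      proof
        assume "\<bar>\<eta>\<bar> = \<rho>"
        then have "\<eta>\<^sup>2 = \<rho>\<^sup>2" by (metis power2_abs)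
        then show False
          using min[of 0 \<theta>] \<alpha> \<theta> \<rho> Bw[of \<eta> \<theta>] Bw[of 0 \<theta>] by (simp add: h_def abs_le_iff)
      qed
      then have "\<bar>\<eta>\<bar> < \<rho>" using \<theta> by simp
      have "g (x + q * (\<theta> - s) + \<eta>) \<theta> + \<beta> / (t - \<theta>)\<^sup>2 \<le> k + q\<^sup>2 / 4"
        using min \<open>\<beta> > 0\<close>
        by (intro supersolution_at_minimum[OF super st(1) \<open>s < \<theta>\<close> \<theta>(3) _ \<open>\<bar>\<eta>\<bar> < \<rho>\<close>, of \<beta> x q \<alpha>])
          (auto simp: h_def w_def)
      moreover have "\<beta> / (t - \<theta>)\<^sup>2 > 0" using \<open>\<beta> > 0\<close> \<theta> by simp
      moreover have "c \<le> g (x + q * (\<theta> - s) + \<eta>) \<theta>"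
        using \<theta> \<rho> by (intro source[OF \<open>s < \<theta>\<close>]) auto
      ultimately show False by (simp add: k_def)
    qed
    then have "h \<eta> s \<le> h 0 \<tau>" using min[of 0 \<tau>] that \<rho> by simp
    moreover have "v x s - e - k * s \<le> h \<eta> s"
    proof -
      have "\<bar>w \<eta> s - v x s\<bar> < e" using d(2)[of "x + \<eta>"] \<theta> \<rho> by (simp add: w_def)
      moreover have "\<alpha> * \<eta>\<^sup>2 \<ge> 0" "\<beta> / (t - s) \<ge> 0" using \<alpha> \<open>\<beta> > 0\<close> st by auto
      ultimately show ?thesis unfolding h_def by linarith
    qed
    ultimately show ?thesis by (simp add: h_def algebra_simps)
  qed
  have "v x s - e - w 0 t + k * (t - s) \<le> 0"
    by (rule le_at_endpoint_if_le_up_to_blowup[OF \<open>s < t\<close> _ key])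
      (use st in \<open>auto simp: w_def intro!: continuous_intros continuous_on_slice_time[OF cont]\<close>)
  then show "v x s + (c - q\<^sup>2 / 4) * (t - s) \<le> v (x + q * (t - s)) t + e"
    by (simp add: w_def k_def)
qed

text \<open>On a short segment inside a bounded region uniform continuity lets the source be evaluated at the end
  point, with one \<open>\<eta>\<close> for all segments.\<close>
lemma supersolution_short_segment:
  assumes cont: "continuous_on (UNIV \<times> {0..}) (\<lambda>(x, t). v x t)"
    and super: "viscosity_supersolution (\<lambda>x t p. p\<^sup>2 + g x t) v"
    and contg: "continuous_on (UNIV \<times> {0..}) (\<lambda>(x, t). g x t)"
    and "\<epsilon> > 0"
  obtains \<eta> where "\<eta> > 0"
    "\<And>y z s t. 0 \<le> s \<Longrightarrow> s < t \<Longrightarrow> t \<le> T \<Longrightarrow> t - s \<le> \<eta> \<Longrightarrow> \<bar>z - y\<bar> \<le> \<eta> \<Longrightarrow> \<bar>z - x\<bar> \<le> X \<Longrightarrow>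
       v y s - (z - y)\<^sup>2 / (4 * (t - s)) + (g z t - \<epsilon>) * (t - s) \<le> v z t"
proof -
  obtain d where d: "d > 0" and uc: "\<And>y s y' t. y \<in> {x - X - 1..x + X + 1} \<Longrightarrow> y' \<in> {x - X - 1..x + X + 1} \<Longrightarrow>
      s \<in> {0..T} \<Longrightarrow> t \<in> {0..T} \<Longrightarrow> \<bar>y - y'\<bar> < d \<Longrightarrow> \<bar>s - t\<bar> < d \<Longrightarrow> \<bar>g y s - g y' t\<bar> < \<epsilon>"
    using uniformly_continuous_on_box[OF contg \<open>\<epsilon> > 0\<close>] by metis
  define \<eta> where "\<eta> = min (1 / 2) (d / 3)"
  have \<eta>: "\<eta> > 0" "2 * \<eta> \<le> 1" "2 * \<eta> < d" using d by (auto simp: \<eta>_def min_def)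
  show ?thesis
  proof (rule that[OF \<eta>(1)])
    fix y z s t :: real
    assume A: "0 \<le> s" "s < t" "t \<le> T" "t - s \<le> \<eta>" "\<bar>z - y\<bar> \<le> \<eta>" "\<bar>z - x\<bar> \<le> X"
    define q where "q = (z - y) / (t - s)"
    have q: "q * (t - s) = z - y" using A by (simp add: q_def)
    have seg: "v y s + ((g z t - \<epsilon>) - q\<^sup>2 / 4) * (t - s) \<le> v (y + q * (t - s)) t"
    proof (rule supersolution_along_segment[OF cont super A(1,2) \<eta>(1)])
      fix y' \<tau> assume \<tau>: "s < \<tau>" "\<tau> < t" "\<bar>y' - (y + q * (\<tau> - s))\<bar> \<le> \<eta>"
      have "y + q * (\<tau> - s) - z = - (q * (t - \<tau>))" using q by (simp add: algebra_simps)
      then have "\<bar>y + q * (\<tau> - s) - z\<bar> = \<bar>q\<bar> * (t - \<tau>)" using \<tau> by (simp add: abs_mult)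
      also have "\<dots> \<le> \<bar>q\<bar> * (t - s)" using \<tau> by (intro mult_left_mono) auto
      also have "\<dots> = \<bar>z - y\<bar>" using A q by (metis abs_mult abs_of_pos diff_gt_0_iff_gt)
      finally have "\<bar>y' - z\<bar> \<le> 2 * \<eta>" using \<tau> A by linarith
      then have "\<bar>g y' \<tau> - g z t\<bar> < \<epsilon>"
        using A \<tau> \<eta> by (intro uc) auto
      then show "g z t - \<epsilon> \<le> g y' \<tau>" by simp
    qed
    have cost: "q\<^sup>2 / 4 * (t - s) = (z - y)\<^sup>2 / (4 * (t - s))"
    proof -
      have "q\<^sup>2 / 4 * r = (q * r)\<^sup>2 / (4 * r)" if "r > 0" for r
        using that by (simp add: power2_eq_square)
      from this[of "t - s"] A have "q\<^sup>2 / 4 * (t - s) = (q * (t - s))\<^sup>2 / (4 * (t - s))"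
        by (simp only: diff_gt_0_iff_gt)
      then show ?thesis by (simp only: q)
    qed
    have "y + q * (t - s) = z" using q by simp
    with seg have "v y s + ((g z t - \<epsilon>) - q\<^sup>2 / 4) * (t - s) \<le> v z t" by (simp only:)
    then show "v y s - (z - y)\<^sup>2 / (4 * (t - s)) + (g z t - \<epsilon>) * (t - s) \<le> v z t"
      unfolding left_diff_distrib[of "g z t - \<epsilon>"] cost by linarith
  qed
qed

section \<open>Near-optimal chains\<close>

text \<open>Convexity of the kinetic cost: moving by \<open>e + d\<close> in time \<open>s + h\<close> costs at most as much as moving by
  \<open>e\<close> in time \<open>s\<close> and then by \<open>d\<close> in time \<open>h\<close>. It is stated without dividing by \<open>s\<close>, because chains
  start with \<open>s = 0\<close>.\<close>
lemma square_add_le_energy: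
  fixes e d s h A :: real
  assumes "s \<ge> 0" "h > 0" "A \<ge> 0" "e\<^sup>2 \<le> 4 * s * A"
  shows "(e + d)\<^sup>2 \<le> 4 * (s + h) * (A + d\<^sup>2 / (4 * h))"
proof -
  have eq: "4 * (s + h) * (A + d\<^sup>2 / (4 * h)) = 4 * s * A + 4 * h * A + s * d\<^sup>2 / h + d\<^sup>2"
    using assms by (simp add: field_simps)
  have "2 * e * d \<le> 4 * h * A + s * d\<^sup>2 / h"
  proof (cases "s = 0")
    case True
    then show ?thesis using assms by simp
  next
    case False
    then have s: "s > 0" using assms by simp
    have "h * e\<^sup>2 / s \<le> h * (4 * s * A) / s" using assms s by (intro divide_right_mono mult_left_mono) auto
    then have "h * e\<^sup>2 / s \<le> 4 * h * A" using s by simp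
    moreover have "h * e\<^sup>2 / s + s * d\<^sup>2 / h - 2 * e * d = (h * e - s * d)\<^sup>2 / (s * h)"
      using s assms by (simp add: field_simps power2_eq_square)
    moreover have "(h * e - s * d)\<^sup>2 / (s * h) \<ge> 0" using s assms by simp
    ultimately show ?thesis by linarith
  qed
  then show ?thesis using assms eq by (simp add: power2_sum)
qed

text \<open>A chain is a discrete path \<open>z 0, \<dots>, z N = x\<close> at the times \<open>k * (T / N)\<close>, along which \<open>u\<close> grows in
  each step by no more than the payoff of that step, up to the error \<open>\<delta> * (T / N)\<close>. The region of radius
  \<open>X\<close> is recorded because it has to stay the same while \<open>\<delta>\<close> tends to \<open>0\<close>.\<close>
definition near_optimal_chain ::
  "(real \<Rightarrow> real \<Rightarrow> real) \<Rightarrow> (real \<Rightarrow> real \<Rightarrow> real) \<Rightarrow> real \<Rightarrow> real \<Rightarrow> real \<Rightarrow> real \<Rightarrow> nat \<Rightarrow> (nat \<Rightarrow> real) \<Rightarrow> bool"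
where
  "near_optimal_chain u f T x X \<delta> N z \<longleftrightarrow>
     N > 0 \<and> T / N \<le> \<delta> \<and> z N = x \<and> (\<forall>k\<le>N. \<bar>z k - x\<bar> \<le> X) \<and>
     (\<forall>k<N. \<bar>z (Suc k) - z k\<bar> \<le> \<delta> \<and>
        u (z (Suc k)) (Suc k * (T / N)) \<le>
          u (z k) (k * (T / N)) - (z (Suc k) - z k)\<^sup>2 / (4 * (T / N))
          + (f (z (Suc k)) (Suc k * (T / N)) + \<delta>) * (T / N))"

text \<open>The chain is built backwards from \<open>x\<close> with one Hopf-Lax step per time interval. Single steps have
  size of order \<open>sqrt (T / N)\<close>, which does not bound the total displacement; what bounds it is that
  the whole kinetic cost has to be paid from \<open>E = M - u x T + K * T\<close>. This is the invariant \<open>P\<close>, where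
  \<open>a i w\<close> bounds what has been spent after \<open>i\<close> backward steps.\<close>
lemma ex_near_optimal_chain:
  assumes cont: "continuous_on (UNIV \<times> {0..}) (\<lambda>(x, t). u x t)"
    and sub: "viscosity_subsolution (\<lambda>x t p. p\<^sup>2 + f x t) u"
    and contf: "continuous_on (UNIV \<times> {0..}) (\<lambda>(x, t). f x t)"
    and T: "T > 0"
    and bound: "\<And>y \<tau>. 0 \<le> \<tau> \<Longrightarrow> \<tau> \<le> T \<Longrightarrow> u y \<tau> \<le> M"
    and K: "0 \<le> K" "\<And>y \<tau>. 0 < \<tau> \<Longrightarrow> \<tau> \<le> T \<Longrightarrow> f y \<tau> \<le> K"
  obtains X where "\<And>\<delta>. \<delta> > 0 \<Longrightarrow> \<exists>N z. near_optimal_chain u f T x X \<delta> N z"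
proof -
  define E where "E = M - u x T + K * T"
  have E: "E \<ge> 0" using bound[of T x] K T by (simp add: E_def)
  define X where "X = sqrt (4 * T * E)"
  have X: "X \<ge> 0" "X\<^sup>2 = 4 * T * E" using E T by (auto simp: X_def)
  show ?thesis
  proof (rule that[of X])
    fix \<delta> :: real assume \<delta>: "\<delta> > 0"
    obtain d where d: "d > 0" and uc: "\<And>y s y' t. y \<in> {x - X - 1..x + X + 1} \<Longrightarrow> y' \<in> {x - X - 1..x + X + 1} \<Longrightarrow>
      s \<in> {0..T} \<Longrightarrow> t \<in> {0..T} \<Longrightarrow> \<bar>y - y'\<bar> < d \<Longrightarrow> \<bar>s - t\<bar> < d \<Longrightarrow> \<bar>f y s - f y' t\<bar> < \<delta>"
      using uniformly_continuous_on_box[OF contf \<delta>] by metis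
    define r where "r = min (min \<delta> 1) (d / 2)"
    have r: "r > 0" "r \<le> \<delta>" "r \<le> 1" "r < d" using d \<delta> by (auto simp: r_def min_def)
    define N where "N = Suc (nat \<lceil>max (T / r) (4 * T * E / r\<^sup>2)\<rceil>)"
    have N: "N > 0" by (simp add: N_def)
    define h where "h = T / N"
    have h: "h > 0" using T N by (simp add: h_def)
    have "max (T / r) (4 * T * E / r\<^sup>2) \<le> N" unfolding N_def by linarith
    then have "T / r \<le> N" "4 * T * E / r\<^sup>2 \<le> N" by auto
    then have hr: "h \<le> r" "4 * h * E \<le> r\<^sup>2"
      using r N by (auto simp: h_def field_simps)
    have Nh: "N * h = T" using N by (simp add: h_def)
    define a where "a i w = u w (T - real i * h) - u x T + K * (real i * h)" for i w
    define P where "P i w \<longleftrightarrow> (i \<le> N \<longrightarrow> 0 \<le> a i w \<and> (w - x)\<^sup>2 \<le> 4 * (real i * h) * a i w)" for i w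
    define S where "S i w y \<longleftrightarrow> (i < N \<longrightarrow> (w - y)\<^sup>2 \<le> r\<^sup>2 \<and>
        u w (T - real i * h) \<le> u y (T - real (Suc i) * h) - (w - y)\<^sup>2 / (4 * h) + (f w (T - real i * h) + \<delta>) * h)"
      for i w y
    have range: "\<bar>w - x\<bar> \<le> X" if "P i w" "i \<le> N" for i w
    proof -
      have ih: "0 \<le> real i * h" "real i * h \<le> T" 
        using that h Nh by (auto simp flip: Nh)
      have aw: "0 \<le> a i w" "(w - x)\<^sup>2 \<le> 4 * (real i * h) * a i w" using that by (auto simp: P_def)
      have "a i w \<le> E" unfolding a_def E_def using bound[of "T - real i * h" w] ih K
        by (intro add_mono diff_mono mult_left_mono) auto
      then have "4 * (real i * h) * a i w \<le> 4 * T * E" using ih aw T by (intro mult_mono) auto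
      then have "(w - x)\<^sup>2 \<le> X\<^sup>2" using aw X by simp
      then show ?thesis using X(1) by (metis abs_le_square_iff abs_of_nonneg)
    qed
    have "\<exists>w. \<forall>i. P i (w i) \<and> S i (w i) (w (Suc i))"
    proof (rule dependent_nat_choice)
      show "\<exists>w. P 0 w" by (auto simp: P_def a_def intro!: exI[of _ x])
    next
      fix w i assume Pw: "P i w"
      show "\<exists>y. P (Suc i) y \<and> S i w y"
      proof (cases "i < N")
        case False
        then show ?thesis by (auto simp: P_def S_def)
      next
        case True
        define t where "t = T - real i * h"
        have aw: "0 \<le> a i w" "(w - x)\<^sup>2 \<le> 4 * (real i * h) * a i w" using Pw True by (auto simp: P_def)
        have "real (Suc i) * h \<le> real N * h" using True h by (intro mult_right_mono) auto
        then have t: "h \<le> t" "t \<le> T" using h Nh by (auto simp: t_def algebra_simps)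
        have E': "M - u w t + K * h \<le> E"
        proof -
          have "u w t \<ge> u x T - K * (real i * h)" using aw by (simp add: a_def t_def)
          moreover have "K * (h + real i * h) \<le> K * T"
            using t K(1) by (intro mult_left_mono) (auto simp: t_def)
          ultimately show ?thesis by (simp add: E_def algebra_simps)
        qed
        \<comment> \<open>The minimum with \<open>K\<close> makes one and the same Hopf-Lax step serve both the invariant and the sharp estimate.\<close>
        define c where "c = min K (f w t + \<delta>)"
        obtain y where y: "u w t \<le> u y (t - h) - (w - y)\<^sup>2 / (4 * (t - (t - h))) + c * (t - (t - h))"
        proof (rule hopf_lax_upper_bound_local[OF cont sub, of "t - h" t M K w c])
          fix y \<tau> assume \<tau>: "t - h < \<tau>" "\<tau> < t"
            and "(w - y)\<^sup>2 \<le> 4 * (t - (t - h)) * (M - u w t + K * (t - (t - h)))"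
          then have "(w - y)\<^sup>2 \<le> 4 * h * (M - u w t + K * h)" by simp
          also have "\<dots> \<le> 4 * h * E" using E' h by (intro mult_left_mono) auto
          also have "\<dots> \<le> r\<^sup>2" by (rule hr)
          finally have wy: "\<bar>w - y\<bar> \<le> r" using r by (metis abs_le_square_iff abs_of_nonneg less_imp_le)
          have "\<bar>f y \<tau> - f w t\<bar> < \<delta>"
            using range[OF Pw] True wy r hr \<tau> t h by (intro uc) auto
          then show "f y \<tau> \<le> c" using K \<tau> t by (auto simp: c_def)
        qed (use t h K bound in auto)
        have step: "u w t \<le> u y (t - h) - (w - y)\<^sup>2 / (4 * h) + c * h" using y by simp
        have th: "t - h = T - real (Suc i) * h" by (simp add: t_def algebra_simps)
        have "c * h \<le> K * h" using h by (intro mult_right_mono) (auto simp: c_def)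
        then have a': "a i w + (w - y)\<^sup>2 / (4 * h) \<le> a (Suc i) y"
          using step by (simp add: a_def t_def th[symmetric] algebra_simps)
        have "0 \<le> (w - y)\<^sup>2 / (4 * h)" using h by simp
        then have "0 \<le> a (Suc i) y" using a' aw by linarith
        moreover have "(y - x)\<^sup>2 \<le> 4 * (real (Suc i) * h) * a (Suc i) y"
        proof -
          have "((w - x) + (y - w))\<^sup>2 \<le> 4 * (real i * h + h) * (a i w + (y - w)\<^sup>2 / (4 * h))"
            by (rule square_add_le_energy) (use aw h in auto)
          also have "\<dots> \<le> 4 * (real i * h + h) * a (Suc i) y"
            using a' h by (intro mult_left_mono) (auto simp: power2_commute)
          finally show ?thesis by (simp add: algebra_simps)
        qed
        ultimately have "P (Suc i) y" by (simp add: P_def)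
        moreover have "S i w y"
        proof -
          have "(w - y)\<^sup>2 / (4 * h) \<le> u y (t - h) - u w t + K * h"
            using step \<open>c * h \<le> K * h\<close> by simp
          also have "\<dots> \<le> M - u w t + K * h" using bound[of "t - h" y] t h by simp
          also have "\<dots> \<le> E" by (rule E')
          finally have "(w - y)\<^sup>2 \<le> 4 * h * E" using h by (simp add: pos_divide_le_eq mult.commute)
          then have "(w - y)\<^sup>2 \<le> r\<^sup>2" using hr by simp
          moreover have "c * h \<le> (f w t + \<delta>) * h" using h by (intro mult_right_mono) (auto simp: c_def)
          then have "u w t \<le> u y (t - h) - (w - y)\<^sup>2 / (4 * h) + (f w t + \<delta>) * h" using step by simp
          ultimately show ?thesis unfolding S_def t_def[symmetric] th[symmetric] by simp
        qed
        ultimately show ?thesis by blast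
      qed
    qed
    then obtain w where w: "\<And>i. P i (w i)" "\<And>i. S i (w i) (w (Suc i))" by blast
    define z where "z k = w (N - k)" for k
    have "w 0 = x" using w(1)[of 0] by (simp add: P_def)
    have "near_optimal_chain u f T x X \<delta> N z"
      unfolding near_optimal_chain_def h_def[symmetric]
    proof (intro conjI allI impI)
      show "h \<le> \<delta>" using hr r by simp
      show "z N = x" using \<open>w 0 = x\<close> by (simp add: z_def)
      fix k
      show "\<bar>z k - x\<bar> \<le> X" if "k \<le> N" using range[OF w(1)] by (simp add: z_def)
      assume k: "k < N"
      have "Suc (N - Suc k) = N - k" using k by simp
      then have S: "S (N - Suc k) (z (Suc k)) (z k)" using w(2)[of "N - Suc k"] by (simp add: z_def)
      have time: "T - real (N - Suc k) * h = Suc k * h" "T - real (Suc (N - Suc k)) * h = k * h"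
        using k by (auto simp: Nh[symmetric] of_nat_diff algebra_simps)
      have SS: "(z (Suc k) - z k)\<^sup>2 \<le> r\<^sup>2"
        "u (z (Suc k)) (Suc k * h) \<le> u (z k) (k * h) - (z (Suc k) - z k)\<^sup>2 / (4 * h) + (f (z (Suc k)) (Suc k * h) + \<delta>) * h"
        using S k unfolding S_def time by auto
      show "u (z (Suc k)) (Suc k * h) \<le> u (z k) (k * h) - (z (Suc k) - z k)\<^sup>2 / (4 * h) + (f (z (Suc k)) (Suc k * h) + \<delta>) * h"
        by (rule SS)
      show "\<bar>z (Suc k) - z k\<bar> \<le> \<delta>"
        using SS(1) r by (metis abs_le_square_iff abs_of_nonneg less_imp_le order_trans)
    qed (use N in auto)
    then show "\<exists>N z. near_optimal_chain u f T x X \<delta> N z" by blast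
  qed
qed

text \<open>In a step of the chain the kinetic costs in the upper bound for \<open>u\<close> and in the lower bound for \<open>v\<close>
  cancel, and so do the sources as far as they agree. Nothing ties \<open>v\<close> to the clock of \<open>u\<close>: the part of the
  chain after index \<open>j\<close> may be traversed by \<open>v\<close> from time \<open>0\<close> on.\<close>
lemma comparison_along_chain:
  assumes cont: "continuous_on (UNIV \<times> {0..}) (\<lambda>(x, t). v x t)"
    and super: "viscosity_supersolution (\<lambda>x t p. p\<^sup>2 + g x t) v"
    and contg: "continuous_on (UNIV \<times> {0..}) (\<lambda>(x, t). g x t)"
    and T: "T > 0" and \<epsilon>: "\<epsilon> > 0"
  obtains \<eta> where "\<eta> > 0"
    "\<And>\<delta> N z (j :: nat). near_optimal_chain u f T x X \<delta> N z \<Longrightarrow> \<delta> \<le> \<eta> \<Longrightarrow> j \<le> N \<Longrightarrow>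
       (\<And>k. j < k \<Longrightarrow> k \<le> N \<Longrightarrow> f (z k) (k * (T / N)) = g (z k) (k * (T / N) - j * (T / N))) \<Longrightarrow>
       u x T - v x (T - j * (T / N)) \<le> u (z j) (j * (T / N)) - v (z j) 0 + \<epsilon>"
proof -
  define e where "e = \<epsilon> / (2 * T)"
  have e: "e > 0" using T \<epsilon> by (simp add: e_def)
  obtain \<eta> where \<eta>: "\<eta> > 0" and seg: "\<And>y z s t. 0 \<le> s \<Longrightarrow> s < t \<Longrightarrow> t \<le> T \<Longrightarrow> t - s \<le> \<eta> \<Longrightarrow> \<bar>z - y\<bar> \<le> \<eta> \<Longrightarrow>
      \<bar>z - x\<bar> \<le> X \<Longrightarrow> v y s - (z - y)\<^sup>2 / (4 * (t - s)) + (g z t - e) * (t - s) \<le> v z t"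
    by (rule supersolution_short_segment[OF cont super contg e, of T x X]) blast
  show ?thesis
  proof (rule that[of "min \<eta> e"])
    fix \<delta> N z and j :: nat
    assume chain: "near_optimal_chain u f T x X \<delta> N z" and \<delta>: "\<delta> \<le> min \<eta> e" and j: "j \<le> N"
      and fg: "\<And>k. j < k \<Longrightarrow> k \<le> N \<Longrightarrow> f (z k) (k * (T / N)) = g (z k) (k * (T / N) - j * (T / N))"
    define h where "h = T / N"
    have N: "N > 0" and zN: "z N = x" and h\<delta>: "h \<le> \<delta>" and zX: "\<And>k. k \<le> N \<Longrightarrow> \<bar>z k - x\<bar> \<le> X"
      and z\<delta>: "\<And>k. k < N \<Longrightarrow> \<bar>z (Suc k) - z k\<bar> \<le> \<delta>"
      and step: "\<And>k. k < N \<Longrightarrow> u (z (Suc k)) (Suc k * h) \<le> u (z k) (k * h) - (z (Suc k) - z k)\<^sup>2 / (4 * h)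
          + (f (z (Suc k)) (Suc k * h) + \<delta>) * h"
      using chain unfolding near_optimal_chain_def h_def by auto
    have h: "h > 0" using T N by (simp add: h_def)
    have Nh: "N * h = T" using N by (simp add: h_def)
    have "u (z (j + i)) (real (j + i) * h) - v (z (j + i)) (real i * h)
        \<le> u (z j) (real j * h) - v (z j) 0 + real i * (2 * e * h)"
      if "j + i \<le> N" for i :: nat
      using that
    proof (induction i)
      case 0
      then show ?case by simp
    next
      case (Suc i)
      let ?k = "j + i"
      have k: "?k < N" using Suc.prems by simp
      have "real (Suc i) * h \<le> N * h" using Suc.prems h by (intro mult_right_mono) auto
      then have iT: "real (Suc i) * h \<le> T" using Nh by simp
      have d: "real (Suc i) * h - i * h = h" by (simp add: algebra_simps)
      have "v (z ?k) (i * h) - (z (Suc ?k) - z ?k)\<^sup>2 / (4 * (real (Suc i) * h - i * h)) +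
          (g (z (Suc ?k)) (Suc i * h) - e) * (Suc i * h - i * h) \<le> v (z (Suc ?k)) (Suc i * h)"
      proof (rule seg)
        show "\<bar>z (Suc ?k) - x\<bar> \<le> X" using zX[of "Suc ?k"] k by simp
        show "\<bar>z (Suc ?k) - z ?k\<bar> \<le> \<eta>" using z\<delta>[OF k] \<delta> by simp
      qed (use h h\<delta> \<delta> iT d in auto)
      moreover have "f (z (Suc ?k)) (Suc ?k * h) = g (z (Suc ?k)) (Suc i * h)"
        using fg[of "Suc ?k"] k by (simp add: h_def[symmetric] algebra_simps)
      moreover have "\<delta> * h \<le> e * h" using \<delta> h by (intro mult_right_mono) auto
      ultimately show ?case
        using step[OF k] Suc.IH k unfolding d by (simp add: algebra_simps)
    qed
    from this[of "N - j"] j zN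
    have "u x (N * h) - v x (real (N - j) * h) \<le> u (z j) (j * h) - v (z j) 0 + real (N - j) * (2 * e * h)" by simp
    moreover have "real (N - j) * h = T - j * h" using j by (simp add: Nh[symmetric] of_nat_diff algebra_simps)
    moreover have "real (N - j) * (2 * e * h) \<le> real N * (2 * e * h)"
      using e h by (intro mult_right_mono) auto
    moreover have "real N * (2 * e * h) = 2 * e * (N * h)" by simp
    then have "real N * (2 * e * h) = \<epsilon>" using Nh T by (simp add: e_def)
    ultimately show "u x T - v x (T - j * (T / N)) \<le> u (z j) (j * (T / N)) - v (z j) 0 + \<epsilon>"
      using Nh unfolding h_def[symmetric] by simp
  qed (use \<eta> e in auto)
qed

section \<open>Solutions with a rising maximum\<close>

lemma C1_partials_add_time:
  assumes "C1_partials \<phi> \<phi>x \<phi>t" "\<And>t. t > 0 \<Longrightarrow> (m has_real_derivative q t) (at t)" "continuous_on {0<..} q"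
  shows "C1_partials (\<lambda>x t. \<phi> x t - m t) \<phi>x (\<lambda>x t. \<phi>t x t - q t)"
proof -
  have "continuous_on (UNIV \<times> {0<..}) (\<lambda>z :: real \<times> real. q (snd z))"
    by (rule continuous_on_compose2[OF assms(3)]) (auto intro!: continuous_intros)
  then show ?thesis
    using assms(1,2) unfolding C1_partials_def split_def
    by (auto intro!: continuous_intros derivative_eq_intros)
qed

lemma viscosity_solution_add_time:
  assumes sol: "viscosity_solution (\<lambda>x t p. p\<^sup>2 + f x t) u"
    and m: "\<And>t. t > 0 \<Longrightarrow> (m has_real_derivative q t) (at t)" and q: "continuous_on {0<..} q"
  shows "viscosity_solution (\<lambda>x t p. p\<^sup>2 + (f x t + q t)) (\<lambda>x t. u x t + m t)"
proof -
  have "\<phi>t x t \<le> (\<phi>x x t)\<^sup>2 + (f x t + q t)"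
    if C1: "C1_partials \<phi> \<phi>x \<phi>t" and t: "t > 0"
      and max: "\<forall>\<^sub>F (y, s) in nhds (x, t). u y s + m s - \<phi> y s \<le> u x t + m t - \<phi> x t" for \<phi> \<phi>x \<phi>t x t
  proof -
    have "\<forall>\<^sub>F (y, s) in nhds (x, t). u y s - (\<phi> y s - m s) \<le> u x t - (\<phi> x t - m t)"
      by (rule eventually_mono[OF max]) auto
    with C1_partials_add_time[OF C1 m q] t sol have "\<phi>t x t - q t \<le> (\<phi>x x t)\<^sup>2 + f x t"
      unfolding viscosity_solution_def viscosity_subsolution_def by blast
    then show ?thesis by simp
  qed
  moreover have "(\<phi>x x t)\<^sup>2 + (f x t + q t) \<le> \<phi>t x t"
    if C1: "C1_partials \<phi> \<phi>x \<phi>t" and t: "t > 0"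
      and min: "\<forall>\<^sub>F (y, s) in nhds (x, t). u x t + m t - \<phi> x t \<le> u y s + m s - \<phi> y s" for \<phi> \<phi>x \<phi>t x t
  proof -
    have "\<forall>\<^sub>F (y, s) in nhds (x, t). u x t - (\<phi> x t - m t) \<le> u y s - (\<phi> y s - m s)"
      by (rule eventually_mono[OF min]) auto
    with C1_partials_add_time[OF C1 m q] t sol have "(\<phi>x x t)\<^sup>2 + f x t \<le> \<phi>t x t - q t"
      unfolding viscosity_solution_def viscosity_supersolution_def by blast
    then show ?thesis by simp
  qed
  ultimately show ?thesis
    unfolding viscosity_solution_def viscosity_subsolution_def viscosity_supersolution_def by blast
qed

lemma subsolution_at_global_maximum:
  assumes sub: "viscosity_subsolution H u" and t: "t > 0"
    and max: "\<And>y s. s > 0 \<Longrightarrow> u y s \<le> u x t"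
  shows "0 \<le> H x t 0"
proof (rule sub[unfolded viscosity_subsolution_def, rule_format, of "\<lambda>_ _. 0" "\<lambda>_ _. 0" "\<lambda>_ _. 0" t x], intro conjI)
  show "C1_partials (\<lambda>_ _. 0) (\<lambda>_ _. 0) (\<lambda>_ _. 0)"
    by (simp add: C1_partials_def split_def)
  have "open ((UNIV :: real set) \<times> {0::real<..})" by (intro open_Times) auto
  then show "\<forall>\<^sub>F (y, s) in nhds (x, t). u y s - 0 \<le> u x t - 0"
    unfolding eventually_nhds using t max by (intro exI[of _ "UNIV \<times> {0<..}"]) auto
qed (rule t)

text \<open>The common form of both solutions after adding the primitive \<open>m\<close> of \<open>Q \<circ> I\<close>. The constraint
  becomes the statement that \<open>m t\<close> is the maximum at time \<open>t\<close>, and the source on \<open>x \<ge> 0\<close> is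
  the time-independent \<open>b\<close>. The function \<open>q\<close> stands for \<open>Q \<circ> I\<close>.\<close>
locale rising_maximum_solution =
  fixes b u0 q m :: "real \<Rightarrow> real" and F U :: "real \<Rightarrow> real \<Rightarrow> real"
  assumes continuous_solution: "continuous_on (UNIV \<times> {0..}) (\<lambda>(x, t). U x t)"
    and solution: "viscosity_solution (\<lambda>x t p. p\<^sup>2 + F x t) U"
    and continuous_source: "continuous_on (UNIV \<times> {0..}) (\<lambda>(x, t). F x t)"
    and source_nonneg: "\<And>x t. x \<ge> 0 \<Longrightarrow> t \<ge> 0 \<Longrightarrow> F x t = b x"
    and source_bounded: "\<And>T. \<exists>K. \<forall>x t. 0 < t \<longrightarrow> t \<le> T \<longrightarrow> F x t \<le> K"
    and initial: "\<And>x. U x 0 = u0 x"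
    and initial_max: "u0 0 = 0" "\<And>x. x \<noteq> 0 \<Longrightarrow> u0 x < 0"
    and le_max: "\<And>x t. t \<ge> 0 \<Longrightarrow> U x t \<le> m t"
    and max_attained: "\<And>t. t > 0 \<Longrightarrow> \<exists>x>0. U x t = m t"
    and max_0: "m 0 = 0"
    and deriv_max: "\<And>t. t \<ge> 0 \<Longrightarrow> (m has_real_derivative q t) (at t within {0..})"
    and strict_mono_rate: "strict_mono_on {0..} q"
begin

lemma continuous_max: "continuous_on {0..} m"
  using deriv_max by (auto simp: continuous_on_eq_continuous_within intro: DERIV_continuous)

lemma deriv_max_at: "t > 0 \<Longrightarrow> (m has_real_derivative q t) (at t)"
  using deriv_max[of t] at_within_interior[of t "{0..}"] by simp

text \<open>The growth rate \<open>q\<close> of \<open>m\<close> increases strictly and \<open>m 0 = 0\<close>, so the last \<open>r\<close> time units contribute more to \<open>m t\<close>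
  than the first \<open>r\<close>.\<close>
lemma max_strictly_superadditive:
  assumes "0 < r" "r < t"
  shows "m (t - r) + m r < m t"
proof -
  have *: "m (t - r) + m r < m t" if r: "0 < r" "r \<le> t - r" for r
  proof -
    obtain x where x: "0 < x" "x < r" "m r - m 0 = (r - 0) * q x"
      using MVT[of 0 r m] r deriv_max_at continuous_on_subset[OF continuous_max, of "{0..r}"]
      by (metis atLeastAtMost_iff atLeast_iff DERIV_unique real_differentiable_def subsetI)
    obtain y where y: "t - r < y" "y < t" "m t - m (t - r) = (t - (t - r)) * q y"
    proof (rule exE[OF MVT2[of "t - r" t m q]])
      show "t - r < t" using r by simp
      show "DERIV m y :> q y" if "t - r \<le> y" for y using deriv_max_at that r by auto
    qed (use that in auto)
    have "q x < q y" using strict_mono_onD[OF strict_mono_rate, of x y] x y r by auto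
    then have "r * q x < r * q y" using r by simp
    moreover have "m r = r * q x" "m t - m (t - r) = r * q y" using x(3) y(3) max_0 by auto
    ultimately show ?thesis by linarith
  qed
  show ?thesis
    using *[of r] *[of "t - r"] assms by (cases "r \<le> t - r") (auto simp: add.commute)
qed

lemma near_optimal_chains:
  assumes "T > 0"
  obtains X where "\<And>\<delta>. \<delta> > 0 \<Longrightarrow> \<exists>N z. near_optimal_chain U F T x X \<delta> N z"
proof -
  have "bounded (m ` {0..T})"
    by (intro compact_imp_bounded compact_continuous_image continuous_on_subset[OF continuous_max]) auto
  then obtain M where M: "\<forall>t\<in>{0..T}. \<bar>m t\<bar> \<le> M" unfolding bounded_iff by auto
  obtain K where K: "\<And>x t. 0 < t \<Longrightarrow> t \<le> T \<Longrightarrow> F x t \<le> K" using source_bounded by blast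
  show ?thesis
  proof (rule ex_near_optimal_chain[OF continuous_solution _ continuous_source assms, of M "max K 0" x])
    show "viscosity_subsolution (\<lambda>x t p. p\<^sup>2 + F x t) U"
      using solution by (simp add: viscosity_solution_def)
    show "U y \<tau> \<le> M" if "0 \<le> \<tau>" "\<tau> \<le> T" for y \<tau>
      using le_max[of \<tau> y] M[rule_format, of \<tau>] that by auto
    show "F y \<tau> \<le> max K 0" if "0 < \<tau>" "\<tau> \<le> T" for y \<tau>
      using K[OF that, of y] by simp
  qed (use that in auto)
qed

end

text \<open>Whole chains from time \<open>0\<close> are used here: both functions start from \<open>u0\<close>, and the sources agree on
  the negative half-line as well.\<close>
lemma rising_maximum_solution_le:
  assumes "rising_maximum_solution b u0 q m F U" "rising_maximum_solution b u0 q' n G V" "t \<ge> 0"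
    and source_eq: "\<And>x t. t \<ge> 0 \<Longrightarrow> F x t = G x t"
  shows "U x t \<le> V x t"
proof (cases "t = 0")
  case True
  then show ?thesis using assms(1,2) by (simp add: rising_maximum_solution.initial)
next
  case False
  then have t: "t > 0" using assms by simp
  interpret U: rising_maximum_solution b u0 q m F U by fact
  interpret V: rising_maximum_solution b u0 q' n G V by fact
  obtain X where X: "\<And>\<delta>. \<delta> > 0 \<Longrightarrow> \<exists>N z. near_optimal_chain U F t x X \<delta> N z"
    using U.near_optimal_chains[OF t] by blast
  show ?thesis
  proof (rule field_le_epsilon)
    fix e :: real assume "e > 0"
    obtain \<eta> where \<eta>: "\<eta> > 0" "\<And>\<delta> N z (j::nat). near_optimal_chain U F t x X \<delta> N z \<Longrightarrow> \<delta> \<le> \<eta> \<Longrightarrow> j \<le> N \<Longrightarrow>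
       (\<And>k. j < k \<Longrightarrow> k \<le> N \<Longrightarrow> F (z k) (k * (t / N)) = G (z k) (k * (t / N) - j * (t / N))) \<Longrightarrow>
       U x t - V x (t - j * (t / N)) \<le> U (z j) (j * (t / N)) - V (z j) 0 + e"
      by (rule comparison_along_chain[OF V.continuous_solution _ V.continuous_source t \<open>e > 0\<close>, of U F x X])
        (use V.solution in \<open>auto simp: viscosity_solution_def\<close>)
    obtain N z where "near_optimal_chain U F t x X \<eta> N z" using X[OF \<eta>(1)] by blast
    from \<eta>(2)[OF this, of 0] t source_eq show "U x t \<le> V x t + e"
      by (simp add: U.initial V.initial)
  qed
qed

text \<open>Take a near-optimal chain for \<open>U\<close> ending at a maximum point \<open>x > 0\<close>, and let \<open>r\<close> be the last time at
  which it is negative (\<open>r = 0\<close> if it never is). After \<open>r\<close> only the common source \<open>b\<close> is seen, and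
  at time \<open>r\<close> the chain is near \<open>0\<close>, where \<open>u0\<close> nearly vanishes while \<open>U\<close> is at most \<open>m r\<close>. Starting
  the rest of the chain at time \<open>0\<close> instead of \<open>r\<close> therefore gives \<open>m t \<le> V x (t - r) + m r\<close> in the limit, and the same for
  \<open>U\<close> in place of \<open>V\<close> with the same \<open>r\<close>. For \<open>0 < r < t\<close> the inequality for \<open>U\<close> contradicts strict
  superadditivity of \<open>m\<close>; for \<open>r = t\<close> the one for \<open>V\<close> contradicts \<open>u0 x < 0\<close>. So \<open>r = 0\<close> and
  \<open>m t \<le> V x t \<le> n t\<close>.\<close>
lemma rising_maximum_le:
  assumes "rising_maximum_solution b u0 q m F U" "rising_maximum_solution b u0 q' n G V" "t > 0"
  shows "m t \<le> n t"
proof -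
  interpret U: rising_maximum_solution b u0 q m F U by fact
  interpret V: rising_maximum_solution b u0 q' n G V by fact
  note t = \<open>t > 0\<close>
  obtain x where x: "x > 0" "U x t = m t" using U.max_attained[OF t] by blast
  obtain X where X: "\<And>\<delta>. \<delta> > 0 \<Longrightarrow> \<exists>N z. near_optimal_chain U F t x X \<delta> N z"
    using U.near_optimal_chains[OF t] by blast
  have near: "\<exists>r\<in>{0..t}. m t \<le> U x (t - r) + m r + e \<and> m t \<le> V x (t - r) + m r + e" if "e > 0" for e
  proof -
    have e: "e / 2 > 0" using that by simp
    obtain \<eta> where \<eta>: "\<eta> > 0" "\<And>\<delta> N z (j::nat). near_optimal_chain U F t x X \<delta> N z \<Longrightarrow> \<delta> \<le> \<eta> \<Longrightarrow> j \<le> N \<Longrightarrow>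
       (\<And>k. j < k \<Longrightarrow> k \<le> N \<Longrightarrow> F (z k) (k * (t / N)) = F (z k) (k * (t / N) - j * (t / N))) \<Longrightarrow>
       U x t - U x (t - j * (t / N)) \<le> U (z j) (j * (t / N)) - U (z j) 0 + e / 2"
      by (rule comparison_along_chain[OF U.continuous_solution _ U.continuous_source t e, of U F x X])
        (use U.solution in \<open>auto simp: viscosity_solution_def\<close>)
    obtain \<eta>' where \<eta>': "\<eta>' > 0" "\<And>\<delta> N z (j::nat). near_optimal_chain U F t x X \<delta> N z \<Longrightarrow> \<delta> \<le> \<eta>' \<Longrightarrow> j \<le> N \<Longrightarrow>
       (\<And>k. j < k \<Longrightarrow> k \<le> N \<Longrightarrow> F (z k) (k * (t / N)) = G (z k) (k * (t / N) - j * (t / N))) \<Longrightarrow>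
       U x t - V x (t - j * (t / N)) \<le> U (z j) (j * (t / N)) - V (z j) 0 + e / 2"
      by (rule comparison_along_chain[OF V.continuous_solution _ V.continuous_source t e, of U F x X])
        (use V.solution in \<open>auto simp: viscosity_solution_def\<close>)
    have "isCont u0 0"
      using continuous_on_slice_space[OF U.continuous_solution, of 0]
      by (simp add: U.initial continuous_on_eq_continuous_at)
    then obtain d where d: "d > 0" "\<And>y. \<bar>y\<bar> < d \<Longrightarrow> \<bar>u0 y\<bar> < e / 2"
      using e U.initial_max(1) unfolding continuous_at_eps_delta dist_real_def by (metis diff_zero)
    define \<delta> where "\<delta> = min (min \<eta> \<eta>') (d / 2)"
    have \<delta>: "\<delta> > 0" "\<delta> \<le> \<eta>" "\<delta> \<le> \<eta>'" "\<delta> < d" using \<eta> \<eta>' d by (auto simp: \<delta>_def min_def)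
    obtain N z where chain: "near_optimal_chain U F t x X \<delta> N z" using X[OF \<delta>(1)] by blast
    then have N: "N > 0" "z N = x" "\<And>k. k < N \<Longrightarrow> \<bar>z (Suc k) - z k\<bar> \<le> \<delta>"
      by (auto simp: near_optimal_chain_def)
    define S where "S = {k \<in> {..N}. z k < 0}"
    define j where "j = (if S = {} then 0 else Max S)"
    have "finite S" by (simp add: S_def)
    then have jS: "j \<in> S" if "S \<noteq> {}" using that by (simp add: j_def)
    have j: "j \<le> N" using jS by (cases "S = {}") (auto simp: j_def S_def)
    have after: "z k \<ge> 0" if "j < k" "k \<le> N" for k
    proof (rule ccontr)
      assume "\<not> z k \<ge> 0"
      then have "k \<in> S" using that by (simp add: S_def)
      then have "k \<le> j" using Max_ge[OF \<open>finite S\<close>, of k] by (auto simp: j_def)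
      then show False using that by simp
    qed
    define h where "h = t / N"
    have h: "h > 0" using t N by (simp add: h_def)
    have "real j * h \<le> N * h" using j h by (intro mult_right_mono) auto
    then have jt: "real j * h \<in> {0..t}" using N h t by (simp add: h_def)
    have start: "U (z j) (j * h) - u0 (z j) \<le> m (j * h) + e / 2"
    proof (cases "S = {}")
      case True
      then show ?thesis using that by (simp add: j_def U.initial U.max_0)
    next
      case False
      then have zj: "z j < 0" using jS by (auto simp: S_def)
      then have "j \<noteq> N" using N x by auto
      then have "j < N" using j by simp
      then have "\<bar>z j\<bar> < d" using N(3)[of j] after[of "Suc j"] zj \<delta> by simp
      then have "\<bar>u0 (z j)\<bar> < e / 2" by (rule d(2))
      then show ?thesis using U.le_max[of "j * h" "z j"] jt by auto
    qed
    have nonneg: "real k * h - j * h \<ge> 0" if "j < k" for k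
      using that h by (simp add: mult_right_mono)
    have "U x t - U x (t - j * h) \<le> U (z j) (j * h) - U (z j) 0 + e / 2"
      using \<eta>(2)[OF chain \<delta>(2) j] after nonneg h U.source_nonneg unfolding h_def[symmetric] by simp
    moreover have "U x t - V x (t - j * h) \<le> U (z j) (j * h) - V (z j) 0 + e / 2"
      using \<eta>'(2)[OF chain \<delta>(3) j] after nonneg h U.source_nonneg V.source_nonneg unfolding h_def[symmetric] by simp
    ultimately have "m t \<le> U x (t - j * h) + m (j * h) + e \<and> m t \<le> V x (t - j * h) + m (j * h) + e"
      using start x by (simp add: U.initial V.initial)
    with jt show ?thesis by blast
  qed
  \<comment> \<open>The times \<open>r\<close> depend on \<open>e\<close>; maximising a continuous function over \<open>{0..t}\<close> replaces them by a limit.\<close>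
  define \<Phi> where "\<Phi> r = min (U x (t - r)) (V x (t - r)) + m r" for r
  have rev: "continuous_on {0..t} (\<lambda>r. W x (t - r))"
    if "continuous_on (UNIV \<times> {0..}) (\<lambda>(x, t). W x t)" for W :: "real \<Rightarrow> real \<Rightarrow> real"
  proof (rule continuous_on_compose2[of "{0..}" "W x" _ "\<lambda>r. t - r"])
    show "continuous_on {0..} (W x)" using continuous_on_slice_time[OF that, of "{0..}" "\<lambda>_. x"] by simp
  qed (auto intro!: continuous_intros)
  have "continuous_on {0..t} \<Phi>" unfolding \<Phi>_def
    by (intro continuous_intros rev[OF U.continuous_solution] rev[OF V.continuous_solution]
        continuous_on_subset[OF U.continuous_max]) auto
  then obtain r where r: "r \<in> {0..t}" "\<And>r'. r' \<in> {0..t} \<Longrightarrow> \<Phi> r' \<le> \<Phi> r"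
    using continuous_attains_sup[of "{0..t}" \<Phi>] t by auto
  have "m t \<le> \<Phi> r"
  proof (rule field_le_epsilon)
    fix e :: real assume "e > 0"
    from near[OF this] obtain r' where "r' \<in> {0..t}" "m t \<le> \<Phi> r' + e" by (auto simp: \<Phi>_def min_def)
    with r show "m t \<le> \<Phi> r + e" by force
  qed
  then have rU: "m t \<le> U x (t - r) + m r" and rV: "m t \<le> V x (t - r) + m r" by (auto simp: \<Phi>_def)
  consider "r = 0" | "r = t" | "0 < r" "r < t" using r(1) by fastforce
  then show ?thesis
  proof cases
    case 1
    then show ?thesis using rV V.le_max[of t x] t U.max_0 by simp
  next
    case 2
    then show ?thesis using rV V.initial U.initial_max(2)[of x] x by simp
  next
    case 3
    then show ?thesis using rU U.le_max[of "t - r" x] U.max_strictly_superadditive[of r t] by simp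
  qed
qed

section \<open>Uniqueness\<close>

theorem theorem1p1:
  fixes I\<^sub>M :: real
    and R R' :: "real \<Rightarrow> real \<Rightarrow> real"
    and b Q u0 :: "real \<Rightarrow> real"
  assumes I\<^sub>M_pos: "I\<^sub>M > 0"
    and R_form: "\<And>x s. s \<ge> 0 \<Longrightarrow> R x s = (if x \<ge> 0 then b x - Q s else R' x s)"
    and A1: "smooth_half_plane R" "\<And>x s. x < 0 \<Longrightarrow> s > 0 \<Longrightarrow> R' x s < 0"
    and A2: "(SUP s\<in>{0..I\<^sub>M}. W2_inf_norm (\<lambda>x. R x s)) < \<infinity>"
            "\<And>x. strict_antimono_on {0..} (R x)"
    and A3: "\<And>s. s \<ge> 0 \<Longrightarrow> Q s \<ge> 0" "strict_mono_on {0..} Q" "Q 0 = 0"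
    and A4: "(SUP x. ereal (R x I\<^sub>M)) = 0"
    and A5: "has_minimum (\<lambda>x. R x 0) 0"
    and A6: "strict_mono_on {0..} b" "b 0 = 0"
    and A7: "\<exists>b'. (\<forall>x\<ge>0. (b has_real_derivative b' x) (at x within {0..})) \<and>
                  (\<exists>L. L-lipschitz_on {0..} b')"
    and A8: "C_k 2 u0" "C_k_norm 2 u0 < \<infinity>" "has_maximum u0 0" "u0 0 = 0"
            "\<And>x. x \<noteq> 0 \<Longrightarrow> u0 x < 0"
  shows "\<forall>u I v J. constrained_HJ_solution R u0 u I \<and> constrained_HJ_solution R u0 v J \<longrightarrow>
           (\<forall>t\<ge>0. I t = J t \<and> (\<forall>x. u x t = v x t))"
proof (intro allI impI, elim conjE)
  fix u v :: "real \<Rightarrow> real \<Rightarrow> real" and I J :: "real \<Rightarrow> real" and t :: real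
  assume sols: "constrained_HJ_solution R u0 u I" "constrained_HJ_solution R u0 v J" and "t \<ge> 0"
  have contR: "continuous_on (UNIV \<times> {0..}) (\<lambda>(x, s). R x s)"
  proof -
    obtain D :: "nat \<Rightarrow> nat \<Rightarrow> real \<Rightarrow> real \<Rightarrow> real" where D:
      "\<And>x s. s \<ge> 0 \<Longrightarrow> D 0 0 x s = R x s"
      "continuous_on (UNIV \<times> {0..}) (\<lambda>(x, s). D 0 0 x s)"
      using A1(1) unfolding smooth_half_plane_def by blast
    show ?thesis by (rule continuous_on_eq[OF D(2)]) (auto simp: D(1))
  qed
  have contQ: "continuous_on {0..} Q"
  proof -
    have "continuous_on {0..} (\<lambda>s. - R 0 s)"
      using continuous_on_slice_time[OF contR, of "{0..}" "\<lambda>_. 0"] by (auto intro!: continuous_intros)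
    moreover have "- R 0 s = Q s" if "s \<ge> 0" for s using R_form[OF that, of 0] A6(2) by simp
    ultimately show ?thesis by (auto cong: continuous_on_cong_simp)
  qed
  define m where "m I t = integral {0..t} (\<lambda>s. Q (I s))" for I :: "real \<Rightarrow> real" and t
  have rising: "rising_maximum_solution b u0 (\<lambda>t. Q (I t)) (m I) (\<lambda>x t. R x (I t) + Q (I t)) (\<lambda>x t. u x t + m I t)"
    if sol: "constrained_HJ_solution R u0 u I" for u I
  proof -
    have I: "continuous_on {0..} I" "strict_mono_on {0..} I" "\<And>t. t \<ge> 0 \<Longrightarrow> 0 \<le> I t"
      and u: "continuous_on (UNIV \<times> {0..}) (\<lambda>(x, t). u x t)"
        "viscosity_solution (\<lambda>x t p. p\<^sup>2 + R x (I t)) u"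
      and max: "\<And>t. t \<ge> 0 \<Longrightarrow> has_maximum (\<lambda>x. u x t) 0"
      and init: "\<And>x. u x 0 = u0 x"
      using sol unfolding constrained_HJ_solution_def by auto
    have I_pos: "0 < I t" if "t > 0" for t
      using strict_mono_onD[OF I(2), of 0 t] I(3)[of 0] that by simp
    have contQI: "continuous_on {0..} (\<lambda>t. Q (I t))"
      by (rule continuous_on_compose2[OF contQ I(1)]) (use I(3) in auto)
    have m0: "m I 0 = 0" by (simp add: m_def)
    have dm: "(m I has_real_derivative Q (I t)) (at t within {0..})" if "t \<ge> 0" for t
    proof -
      have "((\<lambda>s. integral {0..s} (\<lambda>s. Q (I s))) has_real_derivative Q (I t)) (at t within {0..t + 1})"
        by (rule integral_has_real_derivative) (use that continuous_on_subset[OF contQI] in auto)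
      moreover have "at t within {0..t + 1} = at t within {0..}"
        by (rule at_within_nhd[of t "{..<t + 1}"]) auto
      ultimately show ?thesis by (simp add: m_def[abs_def])
    qed
    have dm': "(m I has_real_derivative Q (I t)) (at t)" if "t > 0" for t
      using dm[of t] at_within_interior[of t "{0..}"] that by simp
    have contm: "continuous_on {0..} (m I)"
      using dm by (auto simp: continuous_on_eq_continuous_within intro: DERIV_continuous)
    have mono: "Q (I s) < Q (I t)" if "0 \<le> s" "s < t" for s t
      using strict_mono_onD[OF A3(2), of "I s" "I t"] strict_mono_onD[OF I(2), of s t] I(3) that by simp
    show ?thesis
    proof
      show "continuous_on (UNIV \<times> {0..}) (\<lambda>(x, t). u x t + m I t)"
        using continuous_on_add[OF u(1) continuous_on_comp_snd[OF contm]] by (simp add: split_def)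
      show "viscosity_solution (\<lambda>x t p. p\<^sup>2 + (R x (I t) + Q (I t))) (\<lambda>x t. u x t + m I t)"
        by (rule viscosity_solution_add_time[OF u(2) dm'])
          (use contQI in \<open>auto elim: continuous_on_subset\<close>)
      show "continuous_on (UNIV \<times> {0..}) (\<lambda>(x, t). R x (I t) + Q (I t))"
        using continuous_on_add[OF continuous_on_time_change[OF contR I(1,3)] continuous_on_comp_snd[OF contQI]]
        by (simp add: split_def)
      show "R x (I t) + Q (I t) = b x" if "x \<ge> 0" "t \<ge> 0" for x t
        using R_form[OF I(3)[OF that(2)], of x] that by simp
      show "\<exists>K. \<forall>x t. 0 < t \<longrightarrow> t \<le> T \<longrightarrow> R x (I t) + Q (I t) \<le> K" for T
      proof (intro exI allI impI)
        fix x t assume t: "0 < t" "t \<le> T"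
        have "Q (I t) \<le> Q (I T)" using mono[of t T] t by (cases "t = T") auto
        moreover have "0 \<le> Q I\<^sub>M" using A3(1) I\<^sub>M_pos by simp
        \<comment> \<open>On \<open>x < 0\<close> the growth rate is negative, and on \<open>x \<ge> 0\<close> the condition at \<open>I\<^sub>M\<close> bounds \<open>b\<close>.\<close>
        moreover have "R x (I t) \<le> Q I\<^sub>M"
        proof (cases "x \<ge> 0")
          case True
          have "ereal (R x I\<^sub>M) \<le> 0" unfolding A4[symmetric] by (rule SUP_upper) simp
          then have "b x \<le> Q I\<^sub>M" using R_form[of I\<^sub>M x] I\<^sub>M_pos True by simp
          then show ?thesis using R_form[of "I t" x] I_pos[OF t(1)] A3(1)[of "I t"] True by simp
        next
          case False
          then have "R x (I t) < 0" using R_form[of "I t" x] I_pos[OF t(1)] A1(2)[of x "I t"] by simp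
          then show ?thesis using \<open>0 \<le> Q I\<^sub>M\<close> by simp
        qed
        ultimately show "R x (I t) + Q (I t) \<le> Q I\<^sub>M + Q (I T)" by simp
      qed
      show "u x t + m I t \<le> m I t" if "t \<ge> 0" for x t
        using max[OF that] by (simp add: has_maximum_def)
      \<comment> \<open>At a maximum point the test function \<open>0\<close> gives \<open>R x (I t) \<ge> 0\<close>, which only happens for \<open>x > 0\<close>.\<close>
      show "\<exists>x>0. u x t + m I t = m I t" if t: "t > 0" for t
      proof -
        obtain x where x: "u x t = 0" using max[of t] t by (auto simp: has_maximum_def)
        have "u y s \<le> u x t" if "s > 0" for y s
          using max[of s] that x by (simp add: has_maximum_def)
        moreover have "viscosity_subsolution (\<lambda>x t p. p\<^sup>2 + R x (I t)) u"
          using u(2) by (simp add: viscosity_solution_def)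
        ultimately have "0 \<le> 0\<^sup>2 + R x (I t)" using subsolution_at_global_maximum t by blast
        then have R: "0 \<le> R x (I t)" by simp
        then have "x \<ge> 0" using R_form[of "I t" x] I_pos[OF t] A1(2)[of x "I t"] by (auto split: if_splits)
        moreover have "Q (I t) > 0" using strict_mono_onD[OF A3(2), of 0 "I t"] A3(3) I_pos[OF t] by simp
        ultimately have "b x > 0" using R R_form[of "I t" x] I_pos[OF t] by simp
        then have "x \<noteq> 0" using A6(2) by auto
        then show ?thesis using \<open>x \<ge> 0\<close> x by (intro exI[of _ x]) auto
      qed
      show "strict_mono_on {0..} (\<lambda>t. Q (I t))" using mono by (auto simp: strict_mono_on_def)
    qed (fact init m0 dm A8(4) A8(5) | simp add: init)+
  qed
  note U = rising[OF sols(1)] and V = rising[OF sols(2)]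
  have m_eq: "m I s = m J s" if "s \<ge> 0" for s
    using rising_maximum_le[OF U V, of s] rising_maximum_le[OF V U, of s] that
    by (cases "s = 0") (simp_all add: m_def)
  have IJ: "I s = J s" if s: "s \<ge> 0" for s
  proof -
    have "(m I has_real_derivative Q (I s)) (at s within {0..})"
      by (rule rising_maximum_solution.deriv_max[OF U s])
    moreover have "(m I has_real_derivative Q (J s)) (at s within {0..})"
      by (rule has_field_derivative_transform_within[OF rising_maximum_solution.deriv_max[OF V s], of 1])
        (use s m_eq in auto)
    moreover have "at s within {0..} \<noteq> bot"
      using at_le[of "{s..}" "{0..}" s] s by (auto simp: at_within_Ici_at_right bot_unique)
    ultimately have "Q (I s) = Q (J s)" by (rule has_field_derivative_unique)
    moreover have "0 \<le> I s" "0 \<le> J s" using sols s by (auto simp: constrained_HJ_solution_def)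
    ultimately show ?thesis using strict_mono_on_imp_inj_on[OF A3(2)] by (auto dest: inj_onD)
  qed
  have "u x t + m I t \<le> v x t + m J t" for x
    by (rule rising_maximum_solution_le[OF U V \<open>t \<ge> 0\<close>]) (simp add: IJ)
  moreover have "v x t + m J t \<le> u x t + m I t" for x
    by (rule rising_maximum_solution_le[OF V U \<open>t \<ge> 0\<close>]) (simp add: IJ)
  ultimately show "I t = J t \<and> (\<forall>x. u x t = v x t)"
    using IJ m_eq \<open>t \<ge> 0\<close> by (simp add: antisym)
qed

end
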